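(* Let $X$ and $Y$ be nonzero Banach spaces with type $2$, let $p\in (2,\infty)$ and $\beta \geq 0$. There exists a kernel $K\colon \mathbb{R}^d\times\mathbb{R}^d \to \mathcal{L}(X,Y)$ which satisfies the $(\omega,2)$-Dini condition for some $\omega$ and belongs to $\mathcal{K}_\gamma(L^{r,\infty}(\mathbb{R}^d))$ for some $r\in[2,\infty)$, such that the following holds: if there is a constant $C$ such that for all $w \in A_{p/2}$ we have $$\|K\|_{\mathcal{K}_\gamma(L^p(\mathbb{R}^d,w))} \leq C\, [w]_{A_{p/2}}^{\beta},$$ then $\beta \geq \max\{\tfrac{1}{2},\tfrac{1}{p-2}\}$.
   Context: $\gamma(\mathbb{R}^d;Y):=\gamma(L^2(\mathbb{R}^d),Y)$, where for a Hilbert space $\mathcal{H}$, $\gamma(\mathcal{H},Y)$ is the completion of the finite rank operators $T=\sum_{k=1}^n e_k\otimes x_k$ ($e_k\in\mathcal{H}$ orthonormal, $x_k\in Y$, $(e\otimes x)h=\langle h,e\rangle x$) under $\|T\|=(\mathbb{E}\|\sum_k\gamma_kx_k\|_Y^2)^{1/2}$, with $(\gamma_k)$ independent standard Gaussians. A strongly measurable $f:\mathbb{R}^d\to Y$ with $\langle f,y^*\rangle\in L^2(\mathbb{R}^d)$ for all $y^*\in Y^*$ is identified with the operator $\varphi\mapsto\int f\varphi$ (Pettis integral), and $f\in\gamma(\mathbb{R}^d;Y)$ means that this operator is in $\gamma(L^2(\mathbb{R}^d),Y)$. A weight is a locally integrable $w:\mathbb{R}^d\to(0,\infty)$. For $r>1$,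 $w\in A_r$ if $[w]_{A_r}:=\sup_Q\frac1{|Q|}\int_Qw\cdot\big(\frac1{|Q|}\int_Qw^{1-r'}\big)^{r-1}<\infty$ (sup over cubes with sides parallel to the axes). Let $K:\mathbb{R}^d\times\mathbb{R}^d\to\mathcal{L}(X,Y)$ be strongly measurable (i.e. $(s,t)\mapsto K(s,t)x$ is strongly measurable for each $x\in X$). $K\in\mathcal{K}_\gamma(L^p(\mathbb{R}^d,w))$ (resp. $\mathcal{K}_\gamma(L^{p,\infty}(\mathbb{R}^d,w))$) means that for each $f\in L^p(\mathbb{R}^d,w;X)$ and a.e. $s$ the function $T_Kf(s):=K(s,\cdot)f(\cdot)$ is in $\gamma(\mathbb{R}^d;Y)$ and $T_K$ is bounded from $L^p(\mathbb{R}^d,w;X)$ into $L^p(\mathbb{R}^d,w;\gamma(\mathbb{R}^d;Y))$ (resp. into weak $L^p$, $L^{p,\infty}(\mathbb{R}^d,w;\gamma(\mathbb{R}^d;Y))$); $\|K\|_{\mathcal{K}_\gamma(\cdot)}$ is the operator norm. The weight is omitted if $w\equiv1$. $K$ satisfies the $(\omega,2)$-Dini condition if $\|K(s,t)-K(s',t)\|\le\omega\big(\frac{|s-s'|}{|s-t|}\big)|s-t|^{-d/2}$ for $|s-s'|\le\frac12|s-t|$ and $\|K(s,t)-K(s,t')\|\le\omega\big(\frac{|t-t'|}{|s-t|}\big)|s-t|^{-d/2}$ for $|t-t'|\le\frac12|s-t|$, where $\omega:[0,1]\to[0,\infty)$ is increasing, subadditive, $\omega(0)=0$ and $\int_0^1\omega(r)^2\frac{\mathrm{d}r}r<\infty$.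 *)

theory Defs
  imports "HOL-Probability.Probability"
begin

definition square_integrable :: "('a::euclidean_space \<Rightarrow> real) \<Rightarrow> bool" where
  "square_integrable f \<longleftrightarrow>
     f \<in> borel_measurable lebesgue \<and> integrable lebesgue (\<lambda>x. (f x)\<^sup>2)"

definition L2_eq :: "('a::euclidean_space \<Rightarrow> real) \<Rightarrow> ('a \<Rightarrow> real) \<Rightarrow> bool" where
  "L2_eq f g \<longleftrightarrow> square_integrable f \<and> square_integrable g \<and> (AE x in lebesgue. f x = g x)"

lemma square_integrable_mult:
  assumes "square_integrable f" "square_integrable g"
  shows "integrable lebesgue (\<lambda>x. f x * g x)"
proof (rule Bochner_Integration.integrable_bound)
  show "integrable lebesgue (\<lambda>x. (f x)\<^sup>2 + (g x)\<^sup>2)"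
    using assms by (auto simp: square_integrable_def)
  show "(\<lambda>x. f x * g x) \<in> borel_measurable lebesgue"
    using assms by (auto simp: square_integrable_def)
  have "\<bar>f x * g x\<bar> \<le> (f x)\<^sup>2 + (g x)\<^sup>2" for x
  proof -
    have "2 * (\<bar>f x\<bar> * \<bar>g x\<bar>) \<le> (f x)\<^sup>2 + (g x)\<^sup>2"
      using sum_squares_bound[of "\<bar>f x\<bar>" "\<bar>g x\<bar>"] by simp
    moreover have "0 \<le> \<bar>f x\<bar> * \<bar>g x\<bar>" by simp
    ultimately show ?thesis unfolding abs_mult by linarith
  qed
  then show "AE x in lebesgue. norm (f x * g x) \<le> norm ((f x)\<^sup>2 + (g x)\<^sup>2)"
    by (auto intro!: AE_I2 order_trans[OF _ abs_ge_self])
qed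

lemma square_integrable_0 [simp]: "square_integrable (\<lambda>x. 0)"
  by (simp add: square_integrable_def)

lemma square_integrable_add:
  assumes "square_integrable f" "square_integrable g"
  shows "square_integrable (\<lambda>x. f x + g x)"
  using assms square_integrable_mult[OF assms]
  by (auto simp: square_integrable_def power2_sum mult.assoc)

lemma square_integrable_scale:
  assumes "square_integrable f"
  shows "square_integrable (\<lambda>x. c * f x)"
  using assms by (auto simp: square_integrable_def power_mult_distrib)

quotient_type (overloaded) 'a L2 = "'a::euclidean_space \<Rightarrow> real" / partial: L2_eq
proof (rule part_equivpI)
  show "\<exists>f::'a \<Rightarrow> real. L2_eq f f"
    by (rule exI[of _ "\<lambda>x. 0"]) (simp add: L2_eq_def)
  show "symp (L2_eq :: ('a \<Rightarrow> real) \<Rightarrow> _)"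
    by (auto simp: symp_def L2_eq_def)
  show "transp (L2_eq :: ('a \<Rightarrow> real) \<Rightarrow> _)"
    by (auto simp: transp_def L2_eq_def)
qed

instantiation L2 :: (euclidean_space) real_inner
begin

lift_definition zero_L2 :: "'a L2" is "\<lambda>x. 0"
  by (simp add: L2_eq_def)

lift_definition plus_L2 :: "'a L2 \<Rightarrow> 'a L2 \<Rightarrow> 'a L2" is "\<lambda>f g x. f x + g x"
  by (auto simp: L2_eq_def intro: square_integrable_add)

lift_definition scaleR_L2 :: "real \<Rightarrow> 'a L2 \<Rightarrow> 'a L2" is "\<lambda>c f x. c * f x"
  by (auto simp: L2_eq_def intro: square_integrable_scale)

lift_definition uminus_L2 :: "'a L2 \<Rightarrow> 'a L2" is "\<lambda>f x. - f x"
  using square_integrable_scale[of _ "-1"] by (auto simp: L2_eq_def)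

lift_definition minus_L2 :: "'a L2 \<Rightarrow> 'a L2 \<Rightarrow> 'a L2" is "\<lambda>f g x. f x - g x"
proof -
  fix f f' g g' :: "'a \<Rightarrow> real"
  have *: "square_integrable (\<lambda>x. f x - g x)"
    if "square_integrable f" "square_integrable g" for f g :: "'a \<Rightarrow> real"
    using square_integrable_add[OF that(1) square_integrable_scale[OF that(2), of "-1"]] by simp
  assume "L2_eq f f'" "L2_eq g g'"
  then show "L2_eq (\<lambda>x. f x - g x) (\<lambda>x. f' x - g' x)"
    by (auto simp: L2_eq_def intro: *)
qed

lift_definition inner_L2 :: "'a L2 \<Rightarrow> 'a L2 \<Rightarrow> real"
  is "\<lambda>f g. \<integral>x. f x * g x \<partial>lebesgue"
proof -
  fix f f' g g' :: "'a \<Rightarrow> real"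
  assume "L2_eq f f'" "L2_eq g g'"
  then show "(\<integral>x. f x * g x \<partial>lebesgue) = (\<integral>x. f' x * g' x \<partial>lebesgue)"
    by (intro integral_cong_AE) (auto simp: L2_eq_def square_integrable_def)
qed

definition norm_L2 :: "'a L2 \<Rightarrow> real" where "norm_L2 f = sqrt (f \<bullet> f)"
definition dist_L2 :: "'a L2 \<Rightarrow> 'a L2 \<Rightarrow> real" where "dist_L2 f g = norm (f - g)"
definition sgn_L2 :: "'a L2 \<Rightarrow> 'a L2" where "sgn_L2 f = inverse (norm f) *\<^sub>R f"
definition uniformity_L2 :: "('a L2 \<times> 'a L2) filter" where
  "uniformity_L2 = (INF e\<in>{0 <..}. principal {(x, y). dist x y < e})"
definition open_L2 :: "'a L2 set \<Rightarrow> bool" where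
  "open_L2 U \<longleftrightarrow> (\<forall>x\<in>U. eventually (\<lambda>(x', y). x' = x \<longrightarrow> y \<in> U) uniformity)"

instance
proof
  fix f g h :: "'a L2" and a b r :: real
  show "f + g + h = f + (g + h)"
    by transfer (auto simp: L2_eq_def add.assoc intro!: square_integrable_add)
  show "f + g = g + f"
    by transfer (auto simp: L2_eq_def add.commute intro!: square_integrable_add)
  show "0 + f = f"
    by transfer (auto simp: L2_eq_def)
  show "- f + f = 0"
    by transfer (auto simp: L2_eq_def)
  show "f - g = f + - g"
  proof (transfer, goal_cases)
    case (1 f g)
    then show ?case
      using square_integrable_add[OF _ square_integrable_scale[of _ "-1"], of f g]
      by (auto simp: L2_eq_def)
  qed
  show "a *\<^sub>R (f + g) = a *\<^sub>R f + a *\<^sub>R g"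
    by transfer (auto simp: L2_eq_def distrib_left
        intro!: square_integrable_add square_integrable_scale)
  show "(a + b) *\<^sub>R f = a *\<^sub>R f + b *\<^sub>R f"
    by transfer (auto simp: L2_eq_def distrib_right
        intro!: square_integrable_add square_integrable_scale)
  show "a *\<^sub>R b *\<^sub>R f = (a * b) *\<^sub>R f"
    by transfer (auto simp: L2_eq_def mult.assoc intro!: square_integrable_scale)
  show "1 *\<^sub>R f = f"
    by transfer (auto simp: L2_eq_def)
  show "dist f g = norm (f - g)"
    by (rule dist_L2_def)
  show "sgn f = inverse (norm f) *\<^sub>R f"
    by (rule sgn_L2_def)
  show "(uniformity :: ('a L2 \<times> 'a L2) filter) = (INF e\<in>{0 <..}. principal {(x, y). dist x y < e})"
    by (rule uniformity_L2_def)
  show "open U \<longleftrightarrow> (\<forall>x\<in>U. eventually (\<lambda>(x', y). x' = x \<longrightarrow> y \<in> U) uniformity)" for U :: "'a L2 set"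
    by (rule open_L2_def)
  show "f \<bullet> g = g \<bullet> f"
    by transfer (simp add: mult.commute)
  show "(f + g) \<bullet> h = f \<bullet> h + g \<bullet> h"
    by transfer (auto simp: L2_eq_def distrib_right square_integrable_mult)
  show "r *\<^sub>R f \<bullet> g = r * (f \<bullet> g)"
    by transfer (simp add: mult.assoc)
  show "0 \<le> f \<bullet> f"
    by transfer (simp add: integral_nonneg_AE)
  show "f \<bullet> f = 0 \<longleftrightarrow> f = 0"
  proof (transfer, goal_cases)
    case (1 f)
    then show ?case
      using integral_nonneg_eq_0_iff_AE[of lebesgue "\<lambda>x. f x * f x"]
      by (auto simp: L2_eq_def square_integrable_mult)
  qed
  show "norm f = sqrt (f \<bullet> f)"
    by (rule norm_L2_def)
qed

end

definition gauss_norm :: "nat \<Rightarrow> (nat \<Rightarrow> 'y::real_normed_vector) \<Rightarrow> real" where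
  "gauss_norm n x =
     sqrt (\<integral>\<gamma>. (norm (\<Sum>k<n. \<gamma> k *\<^sub>R x k))\<^sup>2 \<partial>(\<Pi>\<^sub>M k\<in>{..<n}. std_normal_distribution))"

lift_definition rank_one :: "'h::real_inner \<Rightarrow> 'y::real_normed_vector \<Rightarrow> 'h \<Rightarrow>\<^sub>L 'y"
  is "\<lambda>e x h. (h \<bullet> e) *\<^sub>R x"
  by (rule bounded_linear_compose[OF bounded_linear_scaleR_left bounded_linear_inner_left])

definition finite_rank_repr ::
    "nat \<Rightarrow> (nat \<Rightarrow> 'h::real_inner) \<Rightarrow> (nat \<Rightarrow> 'y::real_normed_vector) \<Rightarrow> ('h \<Rightarrow>\<^sub>L 'y) \<Rightarrow> bool" where
  "finite_rank_repr n e x T \<longleftrightarrow>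
     (\<forall>i<n. \<forall>j<n. e i \<bullet> e j = (if i = j then 1 else 0)) \<and> T = (\<Sum>k<n. rank_one (e k) (x k))"

definition finite_rank :: "('h::real_inner \<Rightarrow>\<^sub>L 'y::real_normed_vector) set" where
  "finite_rank = {T. \<exists>n e x. finite_rank_repr n e x T}"

text \<open>The value of \<^const>\<open>gauss_norm\<close> is the same for all representations of one
  operator, by the rotation invariance of Gaussian vectors, so the infimum is over a
  one-element set.\<close>

definition finite_rank_norm :: "('h::real_inner \<Rightarrow>\<^sub>L 'y::real_normed_vector) \<Rightarrow> real" where
  "finite_rank_norm T = Inf {gauss_norm n x | n e x. finite_rank_repr n e x T}"

text \<open>Since the Gaussian norm dominates the operator norm, and a Gaussian-Cauchy sequence of
  finite rank operators that tends to zero in operator norm also tends to zero in the Gaussian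
  norm, the completion of the finite rank operators embeds injectively in the bounded operators.
  It is realised here as the set of operator limits of Gaussian-Cauchy sequences. All approximating
  sequences give the same limit of norms, so the infimum in \<open>gamma_norm\<close> is
  again over a one-element set.\<close>

definition gamma_approx ::
    "(nat \<Rightarrow> 'h::real_inner \<Rightarrow>\<^sub>L 'y::real_normed_vector) \<Rightarrow> ('h \<Rightarrow>\<^sub>L 'y) \<Rightarrow> bool" where
  "gamma_approx S T \<longleftrightarrow> (\<forall>i. S i \<in> finite_rank) \<and>
     (\<forall>\<epsilon>>0. \<exists>N. \<forall>i\<ge>N. \<forall>j\<ge>N. finite_rank_norm (S i - S j) < \<epsilon>) \<and> S \<longlonglongrightarrow> T"

definition gamma_space :: "('h::real_inner \<Rightarrow>\<^sub>L 'y::real_normed_vector) set" where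
  "gamma_space = {T. \<exists>S. gamma_approx S T}"

definition gamma_norm :: "('h::real_inner \<Rightarrow>\<^sub>L 'y::real_normed_vector) \<Rightarrow> real" where
  "gamma_norm T = Inf {c. \<exists>S. gamma_approx S T \<and> (\<lambda>i. finite_rank_norm (S i)) \<longlonglongrightarrow> c}"

text \<open>\<open>strongly_measurable_in V N F\<close>: up to null sets, \<open>F\<close> takes values in \<open>V\<close> and is the limit
  of \<open>V\<close>-valued simple functions with respect to the norm \<open>N\<close> on the space \<open>V\<close>. The library's
  measurability into the Borel sets does not suffice, because the spaces need not be
  separable.\<close>

definition strongly_measurable_in ::
    "'b set \<Rightarrow> ('b \<Rightarrow> real) \<Rightarrow> ('a::euclidean_space \<Rightarrow> 'b::real_vector) \<Rightarrow> bool" where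
  "strongly_measurable_in V N F \<longleftrightarrow> (AE s in lebesgue. F s \<in> V) \<and>
     (\<exists>S. (\<forall>i. simple_function lebesgue (S i) \<and> range (S i) \<subseteq> V) \<and>
          (AE s in lebesgue. (\<lambda>i. N (S i s - F s)) \<longlonglongrightarrow> 0))"

abbreviation strongly_measurable :: "('a::euclidean_space \<Rightarrow> 'b::real_normed_vector) \<Rightarrow> bool" where
  "strongly_measurable \<equiv> strongly_measurable_in UNIV norm"

definition represents ::
    "('a::euclidean_space \<Rightarrow> 'y::real_normed_vector) \<Rightarrow> ('a L2 \<Rightarrow>\<^sub>L 'y) \<Rightarrow> bool" where
  "represents f T \<longleftrightarrow> strongly_measurable f \<and>
     (\<forall>y' :: 'y \<Rightarrow>\<^sub>L real. square_integrable (\<lambda>t. blinfun_apply y' (f t))) \<and>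
     (\<forall>\<phi>. square_integrable \<phi> \<longrightarrow>
        (\<forall>y' :: 'y \<Rightarrow>\<^sub>L real. blinfun_apply y' (blinfun_apply T (abs_L2 \<phi>)) =
           (\<integral>t. blinfun_apply y' (f t) * \<phi> t \<partial>lebesgue)))"

definition fun_operator :: "('a::euclidean_space \<Rightarrow> 'y::real_normed_vector) \<Rightarrow> 'a L2 \<Rightarrow>\<^sub>L 'y" where
  "fun_operator f = (THE T. represents f T)"

definition gamma_function :: "('a::euclidean_space \<Rightarrow> 'y::real_normed_vector) \<Rightarrow> bool" where
  "gamma_function f \<longleftrightarrow> (\<exists>T\<in>gamma_space. represents f T)"

definition ennpowr :: "ennreal \<Rightarrow> real \<Rightarrow> ennreal" where
  "ennpowr x a = (if x = \<top> then \<top> else ennreal (enn2real x powr a))"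

definition weight :: "('a::euclidean_space \<Rightarrow> real) \<Rightarrow> bool" where
  "weight w \<longleftrightarrow> (\<forall>x. w x > 0) \<and> (\<forall>S. compact S \<longrightarrow> w absolutely_integrable_on S)"

definition cubes :: "'a::euclidean_space set set" where
  "cubes = {cbox a (a + l *\<^sub>R One) | a l. l > 0}"

definition average :: "'a::euclidean_space set \<Rightarrow> ('a \<Rightarrow> real) \<Rightarrow> ennreal" where
  "average Q g = (\<integral>\<^sup>+x\<in>Q. ennreal (g x) \<partial>lebesgue) / emeasure lebesgue Q"

text \<open>With the conjugate exponent \<open>r' = r / (r - 1)\<close>.\<close>

definition Ap_const :: "real \<Rightarrow> ('a::euclidean_space \<Rightarrow> real) \<Rightarrow> ennreal" where
  "Ap_const r w = (SUP Q\<in>cubes.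
     average Q w * ennpowr (average Q (\<lambda>x. w x powr (1 - r / (r - 1)))) (r - 1))"

definition Ap_class :: "real \<Rightarrow> ('a::euclidean_space \<Rightarrow> real) set" where
  "Ap_class r = {w. weight w \<and> Ap_const r w < \<top>}"

definition Lp_norm ::
    "real \<Rightarrow> ('a::euclidean_space \<Rightarrow> real) \<Rightarrow> ('b \<Rightarrow> real) \<Rightarrow> ('a \<Rightarrow> 'b) \<Rightarrow> ennreal" where
  "Lp_norm p w N F = ennpowr (\<integral>\<^sup>+s. ennreal (N (F s) powr p * w s) \<partial>lebesgue) (1 / p)"

definition weak_Lp_norm ::
    "real \<Rightarrow> ('a::euclidean_space \<Rightarrow> real) \<Rightarrow> ('b \<Rightarrow> real) \<Rightarrow> ('a \<Rightarrow> 'b) \<Rightarrow> ennreal" where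
  "weak_Lp_norm p w N F = (SUP l\<in>{0<..}.
     ennreal l * ennpowr (\<integral>\<^sup>+s\<in>{s. N (F s) > l}. ennreal (w s) \<partial>lebesgue) (1 / p))"

definition Lp_space ::
    "real \<Rightarrow> ('a::euclidean_space \<Rightarrow> real) \<Rightarrow> ('a \<Rightarrow> 'b::real_normed_vector) set" where
  "Lp_space p w = {f. strongly_measurable f \<and> Lp_norm p w norm f < \<top>}"

type_synonym ('a, 'x, 'y) kernel = "'a \<Rightarrow> 'a \<Rightarrow> 'x \<Rightarrow>\<^sub>L 'y"

definition strongly_measurable_kernel ::
    "('a::euclidean_space, 'x::real_normed_vector, 'y::real_normed_vector) kernel \<Rightarrow> bool" where
  "strongly_measurable_kernel K \<longleftrightarrow>
     (\<forall>x. strongly_measurable (\<lambda>(s, t). blinfun_apply (K s t) x))"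

definition kernel_op ::
    "('a::euclidean_space, 'x::real_normed_vector, 'y::real_normed_vector) kernel \<Rightarrow>
     ('a \<Rightarrow> 'x) \<Rightarrow> 'a \<Rightarrow> ('a L2 \<Rightarrow>\<^sub>L 'y)" where
  "kernel_op K f s = fun_operator (\<lambda>t. blinfun_apply (K s t) (f t))"

text \<open>\<open>target_norm\<close> is the norm of the target space of \<^term>\<open>kernel_op K\<close>: the norm of
  \<open>L\<^sup>p(w; \<gamma>)\<close> or of weak \<open>L\<^sup>p(w; \<gamma>)\<close>.\<close>

definition kernel_bound ::
    "real \<Rightarrow> ('a::euclidean_space \<Rightarrow> real) \<Rightarrow> (('a \<Rightarrow> 'a L2 \<Rightarrow>\<^sub>L 'y) \<Rightarrow> ennreal) \<Rightarrow>
     ('a, 'x::real_normed_vector, 'y::real_normed_vector) kernel \<Rightarrow> real \<Rightarrow> bool" where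
  "kernel_bound p w target_norm K C \<longleftrightarrow> 0 \<le> C \<and>
     (\<forall>f\<in>Lp_space p w.
        (AE s in lebesgue. gamma_function (\<lambda>t. blinfun_apply (K s t) (f t))) \<and>
        strongly_measurable_in gamma_space gamma_norm (kernel_op K f) \<and>
        target_norm (kernel_op K f) \<le> ennreal C * Lp_norm p w norm f)"

definition K_gamma ::
    "real \<Rightarrow> ('a::euclidean_space \<Rightarrow> real) \<Rightarrow>
     ('a, 'x::real_normed_vector, 'y::real_normed_vector) kernel set" where
  "K_gamma p w = {K. \<exists>C. kernel_bound p w (Lp_norm p w gamma_norm) K C}"

definition K_gamma_norm ::
    "real \<Rightarrow> ('a::euclidean_space \<Rightarrow> real) \<Rightarrow>
     ('a, 'x::real_normed_vector, 'y::real_normed_vector) kernel \<Rightarrow> real" where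
  "K_gamma_norm p w K = Inf {C. kernel_bound p w (Lp_norm p w gamma_norm) K C}"

definition K_gamma_weak ::
    "real \<Rightarrow> ('a::euclidean_space \<Rightarrow> real) \<Rightarrow>
     ('a, 'x::real_normed_vector, 'y::real_normed_vector) kernel set" where
  "K_gamma_weak p w = {K. \<exists>C. kernel_bound p w (weak_Lp_norm p w gamma_norm) K C}"

definition dini_modulus :: "(real \<Rightarrow> real) \<Rightarrow> bool" where
  "dini_modulus \<omega> \<longleftrightarrow> \<omega> 0 = 0 \<and> (\<forall>r\<in>{0..1}. 0 \<le> \<omega> r) \<and> mono_on {0..1} \<omega> \<and>
     (\<forall>a b. 0 \<le> a \<and> 0 \<le> b \<and> a + b \<le> 1 \<longrightarrow> \<omega> (a + b) \<le> \<omega> a + \<omega> b) \<and>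
     (\<integral>\<^sup>+r\<in>{0<..1}. ennreal ((\<omega> r)\<^sup>2 / r) \<partial>lebesgue) < \<top>"

text \<open>For \<open>s = t\<close> both conditions are void, since then \<open>s' = s\<close> or \<open>t' = t\<close>.\<close>

definition dini_kernel ::
    "(real \<Rightarrow> real) \<Rightarrow>
     ('a::euclidean_space, 'x::real_normed_vector, 'y::real_normed_vector) kernel \<Rightarrow> bool" where
  "dini_kernel \<omega> K \<longleftrightarrow> dini_modulus \<omega> \<and>
     (\<forall>s s' t. norm (s - s') \<le> norm (s - t) / 2 \<longrightarrow>
        norm (K s t - K s' t) \<le>
          \<omega> (norm (s - s') / norm (s - t)) * norm (s - t) powr (- (real DIM('a) / 2))) \<and>
     (\<forall>s t t'. norm (t - t') \<le> norm (s - t) / 2 \<longrightarrow>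
        norm (K s t - K s t') \<le>
          \<omega> (norm (t - t') / norm (s - t)) * norm (s - t) powr (- (real DIM('a) / 2)))"

definition has_type_2 :: "'x::real_normed_vector itself \<Rightarrow> bool" where
  "has_type_2 _ \<longleftrightarrow> (\<exists>C. \<forall>n. \<forall>x :: nat \<Rightarrow> 'x.
     sqrt (measure_pmf.expectation (Pi_pmf {..<n} 0 (\<lambda>_. pmf_of_set {-1, 1 :: real}))
       (\<lambda>\<epsilon>. (norm (\<Sum>k<n. \<epsilon> k *\<^sub>R x k))\<^sup>2)) \<le> C * sqrt (\<Sum>k<n. (norm (x k))\<^sup>2))"

end

(*
  For d = dim, take the radial kernel K(s,t) = max(|s|,|t|)^(-d/2) (xi (x) y) with a functional xi
  and a vector y; all operators K(s,.)f(.) then have rank one and their gamma norm is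
  |y| (int max(|s|,|t|)^(-d) |xi(f(t))|^2 dt)^(1/2), a Hardy type operator acting on |xi(f)|^2.
  Its weak L^2 bound follows from max(|s|,|t|) >= |s|, and the Dini condition holds with a linear
  modulus.  Writing u = |x|^d and q = p/2, for delta -> 0:
  - the weight u^(delta-1) has A_q constant O(1/delta), and testing on the indicator of the unit
    ball, where int max(|s|,|t|)^(-d) dt ~ log(1/u), shows that the norm is at least
    c delta^(-1/2);
  - the weight u^((1-delta)(q-1)) has A_q constant O(delta^(-(q-1))), and testing on
    u^((delta-1)/2) on the unit ball again gives at least c delta^(-1/2).
  Hence beta >= 1/2 and (q-1) beta >= 1/2.
*)
theory Submission
  imports Defs
begin

text \<open>The gamma norm is defined by infima and limits that are hard to evaluate in general. For
  rank-one operators they collapse: the operator norm is a lower bound, and one explicit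
  representation attains it. That lower bound rests on functionals attaining the norm of a vector,
  hence the Hahn-Banach part. Both tests use one mechanism. Up to constants, the test function
  \<open>f\<close> satisfies \<open>|f|^p w = u^(delta-1)\<close> on the unit ball, and the squared
  gamma norm of its image at \<open>s\<close> dominates \<open>|f(s)|^2 / delta\<close> on a smaller
  or equal ball that keeps a fixed fraction of the weighted mass. For the first weight this ball is
  \<open>u <= exp(-1/delta)\<close>, where the logarithm is at least \<open>1/delta\<close>; for the
  second it is the whole unit ball. The tests are dual in nature: the dual weight of
  \<open>u^((1-delta)(q-1))\<close> is \<open>u^(delta-1)\<close>, and the second test function is
  the square root of that dual weight. In either case the singular power \<open>u^(delta-1)\<close>
  is the only source of the blow-up of the weight constant.\<close>

subsection \<open>Norming functionals\<close>

definition sublinear :: "('v::real_vector \<Rightarrow> real) \<Rightarrow> bool" where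
  "sublinear q \<longleftrightarrow> (\<forall>x y. q (x + y) \<le> q x + q y) \<and> (\<forall>c\<ge>0. \<forall>x. q (c *\<^sub>R x) = c * q x)"

text \<open>For \<open>c > 0\<close> the reverse inequality is the assumed one with factor
  \<open>1 / c\<close> at the vector \<open>c *\<^sub>R x\<close>, so one direction of homogeneity
  is enough to check.\<close>

lemma sublinearI:
  assumes add: "\<And>x y. q (x + y) \<le> q x + q y" and zero: "q 0 = 0"
    and scale: "\<And>c x. c > 0 \<Longrightarrow> q (c *\<^sub>R x) \<le> c * q x"
  shows "sublinear q"
  unfolding sublinear_def
proof (intro conjI allI impI)
  fix c :: real and x
  assume "0 \<le> c"
  show "q (c *\<^sub>R x) = c * q x"
  proof (cases "c = 0")
    case False
    with \<open>0 \<le> c\<close> have "c > 0" by simp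
    from scale[of "1 / c" "c *\<^sub>R x"] \<open>c > 0\<close> have "q x \<le> q (c *\<^sub>R x) / c" by simp
    with \<open>c > 0\<close> have "c * q x \<le> q (c *\<^sub>R x)" by (simp add: field_simps)
    with scale[OF \<open>c > 0\<close>, of x] show ?thesis by simp
  qed (simp add: zero)
qed (rule add)

lemma sublinearD:
  assumes "sublinear q"
  shows "q (x + y) \<le> q x + q y" "c \<ge> 0 \<Longrightarrow> q (c *\<^sub>R x) = c * q x" "q 0 = 0" "- q (- x) \<le> q x"
proof -
  show "q (x + y) \<le> q x + q y" for x y using assms by (simp add: sublinear_def)
  note * = this
  show "c \<ge> 0 \<Longrightarrow> q (c *\<^sub>R x) = c * q x" for c x using assms by (simp add: sublinear_def)
  from this[of 0 0] show "q 0 = 0" by simp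
  with *[of x "- x"] show "- q (- x) \<le> q x" by simp
qed

text \<open>A minimal sublinear functional \<open>q\<close> equals \<open>lowered q w\<close> for every \<open>w\<close>; then
  \<open>q x + q w \<le> q (x + w)\<close>, so \<open>q\<close> is additive.\<close>

definition lowered :: "('v::real_vector \<Rightarrow> real) \<Rightarrow> 'v \<Rightarrow> 'v \<Rightarrow> real" where
  "lowered q w x = (INF t\<in>{0..}. q (x + t *\<^sub>R w) - t * q w)"

lemma lowered_le:
  assumes "sublinear q" "t \<ge> 0"
  shows "lowered q w x \<le> q (x + t *\<^sub>R w) - t * q w"
  unfolding lowered_def
proof (rule cINF_lower)
  \<comment> \<open>An infimum of reals is meaningful only over a set bounded below. Splitting
    \<open>t *\<^sub>R w\<close> into \<open>x + t *\<^sub>R w\<close> and \<open>- x\<close> gives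
    the bound \<open>- q (- x)\<close>, uniform in \<open>t\<close>.\<close>
  show "bdd_below ((\<lambda>t. q (x + t *\<^sub>R w) - t * q w) ` {0..})"
  proof (rule bdd_belowI2)
    fix t :: real assume "t \<in> {0..}"
    then have "t * q w = q (t *\<^sub>R w)" using sublinearD(2)[OF assms(1)] by simp
    also have "\<dots> \<le> q (x + t *\<^sub>R w) + q (- x)"
      using sublinearD(1)[OF assms(1), of "x + t *\<^sub>R w" "- x"] by simp
    finally show "- q (- x) \<le> q (x + t *\<^sub>R w) - t * q w" by simp
  qed
qed (use assms in simp)

lemma lowered_greatest:
  assumes "\<And>t. t \<ge> 0 \<Longrightarrow> c \<le> q (x + t *\<^sub>R w) - t * q w"
  shows "c \<le> lowered q w x"
  unfolding lowered_def by (rule cINF_greatest) (use assms in auto)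

lemma lowered_le_self: "sublinear q \<Longrightarrow> lowered q w x \<le> q x"
  using lowered_le[of q 0 w x] by simp

text \<open>Parameters \<open>t\<close> for \<open>x\<close> and \<open>s\<close> for
  \<open>y\<close> add up to the parameter \<open>t + s\<close> for \<open>x + y\<close>, and
  \<open>t\<close> for \<open>x\<close> becomes \<open>c * t\<close> for the vector scaled by
  \<open>c\<close>.\<close>

lemma sublinear_lowered:
  assumes q: "sublinear q"
  shows "sublinear (lowered q w)"
proof (rule sublinearI)
  fix x y
  have *: "lowered q w (x + y) \<le> (q (x + t *\<^sub>R w) - t * q w) + (q (y + s *\<^sub>R w) - s * q w)"
    if "t \<ge> 0" "s \<ge> 0" for s t
    using lowered_le[OF q, of "t + s" w "x + y"] that
      sublinearD(1)[OF q, of "x + t *\<^sub>R w" "y + s *\<^sub>R w"]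
    by (simp add: algebra_simps)
  \<comment> \<open>Taking the infimum over \<open>t\<close> for fixed \<open>s\<close>, and over
    \<open>s\<close> afterwards, avoids choosing near-minimisers.\<close>
  have "lowered q w (x + y) - (q (y + s *\<^sub>R w) - s * q w) \<le> lowered q w x" if "s \<ge> 0" for s
    by (rule lowered_greatest) (use *[OF _ that] in \<open>simp add: algebra_simps\<close>)
  then have "lowered q w (x + y) - lowered q w x \<le> lowered q w y"
    by (intro lowered_greatest) (simp add: algebra_simps)
  then show "lowered q w (x + y) \<le> lowered q w x + lowered q w y" by simp
next
  have "0 \<le> lowered q w 0"
    by (rule lowered_greatest) (use sublinearD(2)[OF q] in simp)
  with lowered_le_self[OF q, of w 0] sublinearD(3)[OF q] show "lowered q w 0 = 0" by simp
next
  fix c :: real and x assume c: "c > 0"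
  have "lowered q w (c *\<^sub>R x) / c \<le> lowered q w x"
  proof (rule lowered_greatest)
    fix t :: real assume t: "t \<ge> 0"
    have "lowered q w (c *\<^sub>R x) \<le> q (c *\<^sub>R (x + t *\<^sub>R w)) - (c * t) * q w"
      using lowered_le[OF q, of "c * t" w "c *\<^sub>R x"] c t by (simp add: algebra_simps)
    also have "\<dots> = c * (q (x + t *\<^sub>R w) - t * q w)"
      using sublinearD(2)[OF q, of c "x + t *\<^sub>R w"] c by (simp add: right_diff_distrib)
    finally show "lowered q w (c *\<^sub>R x) / c \<le> q (x + t *\<^sub>R w) - t * q w"
      using c by (simp add: field_simps)
  qed
  with c show "lowered q w (c *\<^sub>R x) \<le> c * lowered q w x" by (simp add: field_simps)
qed

lemma minimal_sublinear_is_linear: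
  assumes m: "sublinear m" and min: "\<And>q. sublinear q \<Longrightarrow> q \<le> m \<Longrightarrow> q = m"
  shows "linear m"
proof -
  have "lowered m w = m" for w
    by (rule min[OF sublinear_lowered[OF m]]) (simp add: le_fun_def lowered_le_self[OF m])
  then have "m x + m w \<le> m (x + w)" for x w
    using lowered_le[OF m, of 1 w x] by simp
  with sublinearD(1)[OF m] have add: "m (x + y) = m x + m y" for x y by (simp add: order_antisym)
  have neg: "m (- x) = - m x" for x
    using add[of x "- x"] sublinearD(3)[OF m] by simp
  have "m (c *\<^sub>R x) = c * m x" for c x
  proof (cases "c \<ge> 0")
    case False
    then have "m ((- c) *\<^sub>R x) = - c * m x" by (intro sublinearD(2)[OF m]) simp
    then show ?thesis using neg[of "c *\<^sub>R x"] by simp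
  qed (rule sublinearD(2)[OF m])
  with add show ?thesis by (simp add: linear_iff)
qed

text \<open>The total order of the chain gives subadditivity: the smaller of \<open>q\<close> and
  \<open>r\<close> is below both, so its own subadditivity bounds \<open>u (x + y)\<close> by
  \<open>q x + r y\<close>. The upper bound \<open>p\<close> keeps the infimum finite, since every
  member is at least \<open>- p (- x)\<close> at \<open>x\<close>.\<close>

lemma sublinear_INF_chain:
  assumes "C \<noteq> {}" and C: "\<And>q. q \<in> C \<Longrightarrow> sublinear q \<and> q \<le> p"
    and chain: "\<And>q r. q \<in> C \<Longrightarrow> r \<in> C \<Longrightarrow> q \<le> r \<or> r \<le> q"
  defines "u \<equiv> \<lambda>x. INF q\<in>C. q x"
  shows "sublinear u" "q \<in> C \<Longrightarrow> u \<le> q"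
proof -
  have "bdd_below ((\<lambda>q. q x) ` C)" for x
  proof (rule bdd_belowI2)
    fix q assume "q \<in> C"
    then have "q (- x) \<le> p (- x)" "- q (- x) \<le> q x"
      using C[of q] sublinearD(4)[of q x] by (auto simp: le_fun_def)
    then show "- p (- x) \<le> q x" by simp
  qed
  then have low: "u x \<le> q x" if "q \<in> C" for q x
    unfolding u_def using that by (rule cINF_lower)
  then show "q \<in> C \<Longrightarrow> u \<le> q" by (simp add: le_fun_def)
  have great: "c \<le> u x" if "\<And>q. q \<in> C \<Longrightarrow> c \<le> q x" for c x
    unfolding u_def using \<open>C \<noteq> {}\<close> that by (rule cINF_greatest)
  show "sublinear u"
  proof (rule sublinearI)
    fix x y
    have *: "u (x + y) \<le> q x + r y" if "q \<in> C" "r \<in> C" for q r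
    proof -
      obtain t where t: "t \<in> C" "t \<le> q" "t \<le> r" using chain[of q r] \<open>q \<in> C\<close> \<open>r \<in> C\<close> by auto
      have "u (x + y) \<le> t (x + y)" using t low by simp
      also have "\<dots> \<le> t x + t y" using C t sublinearD(1) by blast
      also have "\<dots> \<le> q x + r y" using t by (intro add_mono) (auto simp: le_fun_def)
      finally show ?thesis .
    qed
    have "u (x + y) - r y \<le> u x" if "r \<in> C" for r
      by (rule great) (use *[OF _ that] in \<open>simp add: algebra_simps\<close>)
    then have "u (x + y) - u x \<le> u y"
      by (intro great) (simp add: algebra_simps)
    then show "u (x + y) \<le> u x + u y" by simp
  next
    obtain q where "q \<in> C" using \<open>C \<noteq> {}\<close> by auto
    show "u 0 = 0"
      using great[of 0 0] low[OF \<open>q \<in> C\<close>, of 0] C sublinearD(3) \<open>q \<in> C\<close>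
      by (metis order_antisym order_refl)
  next
    fix c :: real and x assume c: "c > 0"
    have "u (c *\<^sub>R x) / c \<le> u x"
    proof (rule great)
      fix q assume "q \<in> C"
      then have "u (c *\<^sub>R x) \<le> c * q x"
        using low[of q "c *\<^sub>R x"] C sublinearD(2)[of q c x] c by auto
      then show "u (c *\<^sub>R x) / c \<le> q x" using c by (simp add: field_simps)
    qed
    with c show "u (c *\<^sub>R x) \<le> c * u x" by (simp add: field_simps)
  qed
qed

text \<open>Zorn's lemma for the reversed pointwise order yields a minimal element among the
  sublinear functionals below \<open>p\<close>. It is minimal among all of them, since whatever lies
  below it lies below \<open>p\<close>.\<close>

lemma exists_linear_below_sublinear:
  assumes p: "sublinear p"
  shows "\<exists>m. linear m \<and> m \<le> p"
proof -
  define A where "A = {q. sublinear q \<and> q \<le> p}"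
  have "\<exists>m\<in>A. \<forall>a\<in>A. a \<le> m \<longrightarrow> a = m"
  proof (rule predicate_Zorn)
    show "partial_order_on A (relation_of (\<lambda>a b. b \<le> a) A)"
      by (auto simp: partial_order_on_def preorder_on_def refl_on_def trans_def antisym_def
          relation_of_def)
    fix C assume C: "C \<in> Chains (relation_of (\<lambda>a b. b \<le> a) A)"
    show "\<exists>u\<in>A. \<forall>a\<in>C. u \<le> a"
    proof (cases "C = {}")
      case True
      with p show ?thesis by (auto simp: A_def)
    next
      case False
      have 1: "sublinear q \<and> q \<le> p" if "q \<in> C" for q
        using C that by (auto simp: Chains_def relation_of_def A_def)
      have 2: "q \<le> r \<or> r \<le> q" if "q \<in> C" "r \<in> C" for q r
        using C that by (auto simp: Chains_def relation_of_def)
      obtain q where "q \<in> C" using False by auto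
      with sublinear_INF_chain[OF False 1 2] 1 show ?thesis
        unfolding A_def by (intro bexI[of _ "\<lambda>x. INF q\<in>C. q x"]) (auto intro: order_trans)
    qed
  qed
  then obtain m where m: "sublinear m" "m \<le> p" "\<And>a. sublinear a \<Longrightarrow> a \<le> p \<Longrightarrow> a \<le> m \<Longrightarrow> a = m"
    by (auto simp: A_def)
  have "linear m"
    using m by (intro minimal_sublinear_is_linear) (auto intro: order_trans)
  with m show ?thesis by auto
qed

text \<open>The linear functional is taken below \<open>lowered norm v\<close> instead of
  \<open>norm\<close>. The parameter \<open>t = 1\<close> bounds \<open>lowered norm v (- v)\<close>
  by \<open>- norm v\<close>, which forces the functional to attain the norm at \<open>v\<close>; no
  extension from the line through \<open>v\<close> takes place.\<close>

lemma norming_functional: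
  fixes v :: "'v::real_normed_vector"
  obtains f :: "'v \<Rightarrow>\<^sub>L real" where "\<And>x. \<bar>blinfun_apply f x\<bar> \<le> norm x" "blinfun_apply f v = norm v"
proof -
  have sn: "sublinear (norm :: 'v \<Rightarrow> real)"
    by (simp add: sublinear_def norm_triangle_ineq)
  obtain m where m: "linear m" "m \<le> lowered norm v"
    using exists_linear_below_sublinear[OF sublinear_lowered[OF sn]] by blast
  have le: "m x \<le> norm x" for x
    using m(2) lowered_le_self[OF sn, of v x] by (auto simp: le_fun_def intro: order_trans)
  have neg: "m (- x) = - m x" for x using m(1) by (rule linear_neg)
  have abs: "\<bar>m x\<bar> \<le> norm x" for x
    using le[of x] le[of "- x"] neg[of x] by simp
  have "m (- v) \<le> - norm v"
    using m(2) lowered_le[OF sn, of 1 v "- v"] by (auto simp: le_fun_def intro: order_trans)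
  with le[of v] neg[of v] have "m v = norm v" by simp
  moreover have "bounded_linear m"
    using m(1) abs by (intro bounded_linear_intro[of _ 1]) (auto simp: linear_iff)
  ultimately show thesis
    using abs by (intro that[of "Blinfun m"]) (auto simp: bounded_linear_Blinfun_apply)
qed

lemma functionals_separate_points:
  fixes v w :: "'v::real_normed_vector"
  assumes "\<And>f :: 'v \<Rightarrow>\<^sub>L real. blinfun_apply f v = blinfun_apply f w"
  shows "v = w"
proof -
  obtain f :: "'v \<Rightarrow>\<^sub>L real" where "blinfun_apply f (v - w) = norm (v - w)"
    by (rule norming_functional)
  with assms[of f] show ?thesis by (simp add: blinfun.diff_right)
qed
subsection \<open>The Gaussian norm\<close>

abbreviation gauss_product :: "nat \<Rightarrow> (nat \<Rightarrow> real) measure" where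
  "gauss_product n \<equiv> (\<Pi>\<^sub>M k\<in>{..<n}. std_normal_distribution)"

section \<open>Second moments of Gaussian sums\<close>

lemma std_normal_moments:
  "integrable std_normal_distribution (\<lambda>x. x)" "(\<integral>x. x \<partial>std_normal_distribution) = 0"
  "integrable std_normal_distribution (\<lambda>x. x * x)" "(\<integral>x. x * x \<partial>std_normal_distribution) = 1"
proof -
  note density = integrable_density[of _ lborel std_normal_density]
    integral_density[of _ lborel std_normal_density]
  have nonneg: "AE x in lborel. 0 \<le> std_normal_density x" by simp
  show "integrable std_normal_distribution (\<lambda>x. x)"
    using integrable_std_normal_moment[of 1] by (subst density(1)) (auto simp: nonneg)
  show "(\<integral>x. x \<partial>std_normal_distribution) = 0"
    using integral_std_normal_moment_odd[of 0] by (subst density(2)) (auto simp: nonneg)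
  show "integrable std_normal_distribution (\<lambda>x. x * x)"
    using integrable_std_normal_moment[of 2]
    by (subst density(1)) (auto simp: nonneg power2_eq_square)
  show "(\<integral>x. x * x \<partial>std_normal_distribution) = 1"
    using integral_std_normal_moment_even[of 1]
    by (subst density(2)) (auto simp: nonneg power2_eq_square)
qed

lemma gauss_product_covariance:
  assumes "i < n" "j < n"
  shows "integrable (gauss_product n) (\<lambda>\<gamma>. \<gamma> i * \<gamma> j)"
    and "(\<integral>\<gamma>. \<gamma> i * \<gamma> j \<partial>gauss_product n) = (if i = j then 1 else 0)"
proof -
  interpret N: prob_space std_normal_distribution by (rule prob_space_normal_density) simp
  interpret product_sigma_finite "\<lambda>_::nat. std_normal_distribution"
    by (simp add: product_sigma_finite_def N.sigma_finite_measure_axioms)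
  \<comment> \<open>Writing the product of two coordinates as a product over all coordinates, with
    factors \<open>x * x\<close>, \<open>x\<close> or \<open>1\<close>, makes Fubini applicable and
    treats \<open>i = j\<close> and \<open>i \<noteq> j\<close> together.\<close>
  define f :: "nat \<Rightarrow> real \<Rightarrow> real" where
    "f k x = (if k = i then x else 1) * (if k = j then x else 1)" for k x
  have prod: "\<gamma> i * \<gamma> j = (\<Prod>k<n. f k (\<gamma> k))" for \<gamma> :: "nat \<Rightarrow> real"
    using assms by (simp add: f_def prod.distrib prod.delta)
  have f: "f k = (if k = i then if k = j then (\<lambda>x. x * x) else (\<lambda>x. x) else if k = j then (\<lambda>x. x) else (\<lambda>x. 1))" for k
    by (rule ext) (simp add: f_def)
  have one: "integrable std_normal_distribution (\<lambda>x. 1 :: real)" "(\<integral>x. 1 \<partial>std_normal_distribution) = (1 :: real)"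
    by (rule N.integrable_const) (use N.prob_space in \<open>simp only: lebesgue_integral_const\<close>, simp)
  have int: "integrable std_normal_distribution (f k)" for k
    unfolding f by (simp only: std_normal_moments one split: if_split) simp
  show "integrable (gauss_product n) (\<lambda>\<gamma>. \<gamma> i * \<gamma> j)"
    unfolding prod by (rule product_integrable_prod) (rule finite_lessThan int)+
  have E: "(\<integral>x. f k x \<partial>std_normal_distribution) = (if k = i \<or> k = j then (if i = j then 1 else 0) else 1)" for k
    unfolding f by (simp only: std_normal_moments one split: if_split) simp
  have "(\<integral>\<gamma>. \<gamma> i * \<gamma> j \<partial>gauss_product n) = (\<Prod>k<n. \<integral>x. f k x \<partial>std_normal_distribution)"
    unfolding prod by (rule product_integral_prod) (rule finite_lessThan int)+
  also have "\<dots> = (if i = j then 1 else 0)"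
    unfolding E using assms by (auto intro: prod.neutral)
  finally show "(\<integral>\<gamma>. \<gamma> i * \<gamma> j \<partial>gauss_product n) = (if i = j then 1 else 0)" .
qed

lemma gauss_product_second_moment:
  fixes a :: "nat \<Rightarrow> real"
  shows "integrable (gauss_product n) (\<lambda>\<gamma>. (\<Sum>k<n. \<gamma> k * a k)\<^sup>2)"
    and "(\<integral>\<gamma>. (\<Sum>k<n. \<gamma> k * a k)\<^sup>2 \<partial>gauss_product n) = (\<Sum>k<n. (a k)\<^sup>2)"
proof -
  have *: "(\<Sum>k<n. \<gamma> k * a k)\<^sup>2 = (\<Sum>i<n. \<Sum>j<n. (a i * a j) * (\<gamma> i * \<gamma> j))" for \<gamma>
    unfolding power2_eq_square sum_product by (simp add: ac_simps)
  show "integrable (gauss_product n) (\<lambda>\<gamma>. (\<Sum>k<n. \<gamma> k * a k)\<^sup>2)"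
    unfolding * using gauss_product_covariance(1)
    by (intro Bochner_Integration.integrable_sum integrable_mult_right) auto
  have "(\<integral>\<gamma>. (\<Sum>k<n. \<gamma> k * a k)\<^sup>2 \<partial>gauss_product n)
    = (\<Sum>i<n. \<Sum>j<n. (a i * a j) * (\<integral>\<gamma>. \<gamma> i * \<gamma> j \<partial>gauss_product n))"
    unfolding * using gauss_product_covariance(1)
    by (subst Bochner_Integration.integral_sum Bochner_Integration.integral_sum,
        auto intro!: Bochner_Integration.integrable_sum integrable_mult_right)+
  also have "\<dots> = (\<Sum>i<n. \<Sum>j<n. if i = j then (a i)\<^sup>2 else 0)"
    by (intro sum.cong refl) (auto simp: gauss_product_covariance(2) power2_eq_square)
  also have "\<dots> = (\<Sum>k<n. (a k)\<^sup>2)"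
    by (simp add: sum.delta)
  finally show "(\<integral>\<gamma>. (\<Sum>k<n. \<gamma> k * a k)\<^sup>2 \<partial>gauss_product n) = (\<Sum>k<n. (a k)\<^sup>2)" .
qed

text \<open>The target space need not be separable, so that sums of Borel functions need not be Borel;
  but the norm of the sum is a continuous function of the countable sequence of coefficients.\<close>

lemma borel_measurable_norm_gauss_sum:
  fixes x :: "nat \<Rightarrow> 'y::real_normed_vector"
  shows "(\<lambda>\<gamma>. norm (\<Sum>k<n. \<gamma> k *\<^sub>R x k)) \<in> borel_measurable (gauss_product n)"
proof -
  define E where "E \<gamma> = (\<lambda>k. if k < n then \<gamma> k else 0)" for \<gamma> :: "nat \<Rightarrow> real"
  have "E \<in> measurable (gauss_product n) (PiM UNIV (\<lambda>_. borel))"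
    unfolding E_def
  proof (rule measurable_PiM_single')
    fix k
    show "(\<lambda>\<gamma>. if k < n then \<gamma> k else 0) \<in> borel_measurable (gauss_product n)"
    proof (cases "k < n")
      case True
      then have "(\<lambda>\<gamma>. \<gamma> k) \<in> measurable (gauss_product n) std_normal_distribution"
        by (intro measurable_component_singleton) simp
      with True show ?thesis by simp
    qed simp
  qed simp
  then have E: "E \<in> measurable (gauss_product n) borel"
    by (simp add: measurable_cong_sets[OF refl sets_PiM_equal_borel])
  have "continuous_on UNIV (\<lambda>\<gamma> :: nat \<Rightarrow> real. norm (\<Sum>k<n. \<gamma> k *\<^sub>R x k))"
    by (intro continuous_intros continuous_on_product_coordinates)
  then have "(\<lambda>\<gamma> :: nat \<Rightarrow> real. norm (\<Sum>k<n. \<gamma> k *\<^sub>R x k)) \<in> borel_measurable borel"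
    by (rule borel_measurable_continuous_onI)
  from measurable_compose[OF E this] show ?thesis by (simp add: E_def)
qed

text \<open>Cauchy-Schwarz supplies an integrable majorant: the sum of the squared Gaussians times a
  constant.\<close>

lemma integrable_norm_gauss_sum:
  fixes x :: "nat \<Rightarrow> 'y::real_normed_vector"
  shows "integrable (gauss_product n) (\<lambda>\<gamma>. (norm (\<Sum>k<n. \<gamma> k *\<^sub>R x k))\<^sup>2)"
proof (rule Bochner_Integration.integrable_bound)
  show "integrable (gauss_product n) (\<lambda>\<gamma>. (\<Sum>k<n. \<gamma> k * \<gamma> k) * (\<Sum>k<n. (norm (x k))\<^sup>2))"
    using gauss_product_covariance(1)
    by (intro integrable_mult_left Bochner_Integration.integrable_sum) auto
  show "(\<lambda>\<gamma>. (norm (\<Sum>k<n. \<gamma> k *\<^sub>R x k))\<^sup>2) \<in> borel_measurable (gauss_product n)"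
    using borel_measurable_norm_gauss_sum[where n = n and x = x] by measurable
  have "(norm (\<Sum>k<n. \<gamma> k *\<^sub>R x k))\<^sup>2 \<le> (\<Sum>k<n. \<gamma> k * \<gamma> k) * (\<Sum>k<n. (norm (x k))\<^sup>2)" for \<gamma>
  proof -
    have "(norm (\<Sum>k<n. \<gamma> k *\<^sub>R x k))\<^sup>2 \<le> (\<Sum>k<n. \<bar>\<gamma> k\<bar> * norm (x k))\<^sup>2"
      by (intro power_mono sum_norm_le) auto
    also have "\<dots> \<le> (\<Sum>k<n. \<bar>\<gamma> k\<bar>\<^sup>2) * (\<Sum>k<n. (norm (x k))\<^sup>2)"
      by (rule Cauchy_Schwarz_ineq_sum)
    finally show ?thesis by (simp add: power2_eq_square)
  qed
  then show "AE \<gamma> in gauss_product n. norm ((norm (\<Sum>k<n. \<gamma> k *\<^sub>R x k))\<^sup>2)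
      \<le> norm ((\<Sum>k<n. \<gamma> k * \<gamma> k) * (\<Sum>k<n. (norm (x k))\<^sup>2))"
    by (auto intro!: AE_I2 order_trans[OF _ abs_ge_self])
qed

lemma gauss_norm_nonneg: "0 \<le> gauss_norm n x"
  by (simp add: gauss_norm_def integral_nonneg_AE)

text \<open>A contractive functional turns the vector-valued Gaussian sum into a scalar one, whose
  second moment is explicit.\<close>

lemma gauss_norm_ge_functional:
  assumes "\<And>v. \<bar>blinfun_apply f v\<bar> \<le> norm v"
  shows "sqrt (\<Sum>k<n. (blinfun_apply f (x k))\<^sup>2) \<le> gauss_norm n x"
proof -
  have "(\<Sum>k<n. (blinfun_apply f (x k))\<^sup>2)
      = (\<integral>\<gamma>. (\<Sum>k<n. \<gamma> k * blinfun_apply f (x k))\<^sup>2 \<partial>gauss_product n)"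
    by (simp add: gauss_product_second_moment)
  also have "\<dots> \<le> (\<integral>\<gamma>. (norm (\<Sum>k<n. \<gamma> k *\<^sub>R x k))\<^sup>2 \<partial>gauss_product n)"
  proof (rule integral_mono)
    fix \<gamma>
    have "(\<Sum>k<n. \<gamma> k * blinfun_apply f (x k)) = blinfun_apply f (\<Sum>k<n. \<gamma> k *\<^sub>R x k)"
      by (simp add: blinfun.sum_right blinfun.scaleR_right)
    then show "(\<Sum>k<n. \<gamma> k * blinfun_apply f (x k))\<^sup>2 \<le> (norm (\<Sum>k<n. \<gamma> k *\<^sub>R x k))\<^sup>2"
      using assms by (simp add: abs_le_square_iff [symmetric])
  qed (rule gauss_product_second_moment integrable_norm_gauss_sum)+
  finally show ?thesis by (simp add: gauss_norm_def)
qed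

section \<open>Operator norm and gamma norm of rank-one operators\<close>

lemma bessel_inequality:
  fixes h :: "'h::real_inner" and n :: nat
  assumes "\<forall>i<n. \<forall>j<n. e i \<bullet> e j = (if i = j then 1 else (0::real))"
  shows "sqrt (\<Sum>k<n. (h \<bullet> e k)\<^sup>2) \<le> norm h"
proof -
  define z where "z = (\<Sum>k<n. (h \<bullet> e k) *\<^sub>R e k)"
  have hz: "h \<bullet> z = (\<Sum>k<n. (h \<bullet> e k)\<^sup>2)"
    by (simp add: z_def inner_sum_right power2_eq_square)
  have "e i \<bullet> z = h \<bullet> e i" if "i < n" for i
  proof -
    have "e i \<bullet> z = (\<Sum>k<n. if i = k then h \<bullet> e k else 0)"
      unfolding z_def inner_sum_right by (intro sum.cong) (use assms that in auto)
    also have "\<dots> = h \<bullet> e i" using that by (subst sum.delta') auto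
    finally show ?thesis .
  qed
  then have "z \<bullet> z = h \<bullet> z"
    by (subst z_def) (simp add: inner_sum_left hz power2_eq_square)
  then have nz: "(norm z)\<^sup>2 = h \<bullet> z" by (simp add: power2_norm_eq_inner)
  have "norm z \<le> norm h"
  proof (cases "z = 0")
    case False
    have "norm z * norm z \<le> norm h * norm z"
      using nz norm_cauchy_schwarz[of h z] by (simp add: power2_eq_square)
    then show ?thesis using False by simp
  qed simp
  then show ?thesis by (simp add: hz [symmetric] nz [symmetric])
qed

text \<open>A functional that attains the norm of \<open>blinfun_apply T h\<close> makes the
  estimate scalar. Cauchy-Schwarz then splits it into the coefficients of \<open>h\<close>, bounded
  by Bessel, and the values on \<open>x k\<close>, bounded by the Gaussian norm.\<close>

lemma norm_le_gauss_norm: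
  fixes T :: "'h::real_inner \<Rightarrow>\<^sub>L 'y::real_normed_vector"
  assumes "finite_rank_repr n e x T"
  shows "norm T \<le> gauss_norm n x"
proof (rule norm_blinfun_bound)
  fix h
  obtain f :: "'y \<Rightarrow>\<^sub>L real" where f: "\<And>v. \<bar>blinfun_apply f v\<bar> \<le> norm v"
      "blinfun_apply f (blinfun_apply T h) = norm (blinfun_apply T h)"
    by (rule norming_functional[of "blinfun_apply T h"]) blast
  have "blinfun_apply T h = (\<Sum>k<n. (h \<bullet> e k) *\<^sub>R x k)"
    using assms by (simp add: finite_rank_repr_def blinfun.sum_left rank_one.rep_eq)
  then have "norm (blinfun_apply T h) = (\<Sum>k<n. (h \<bullet> e k) * blinfun_apply f (x k))"
    using f(2) by (simp add: blinfun.sum_right blinfun.scaleR_right)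
  also have "\<dots> \<le> sqrt (\<Sum>k<n. (h \<bullet> e k)\<^sup>2) * sqrt (\<Sum>k<n. (blinfun_apply f (x k))\<^sup>2)"
    unfolding real_sqrt_mult [symmetric] by (rule real_le_rsqrt[OF Cauchy_Schwarz_ineq_sum])
  also have "\<dots> \<le> norm h * gauss_norm n x"
    using assms f(1)
    by (intro mult_mono bessel_inequality gauss_norm_ge_functional)
      (auto simp: finite_rank_repr_def sum_nonneg)
  finally show "norm (blinfun_apply T h) \<le> gauss_norm n x * norm h" by (simp add: mult.commute)
qed (rule gauss_norm_nonneg)

lemma norm_rank_one: "norm (rank_one h y) = norm h * norm y"
proof (rule antisym)
  show "norm (rank_one h y) \<le> norm h * norm y"
  proof (rule norm_blinfun_bound)
    fix g
    show "norm (blinfun_apply (rank_one h y) g) \<le> norm h * norm y * norm g"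
      using mult_right_mono[OF Cauchy_Schwarz_ineq2[of g h], of "norm y"]
      by (simp add: rank_one.rep_eq ac_simps)
  qed simp
  have "norm h * norm h * norm y \<le> norm (rank_one h y) * norm h"
    using norm_blinfun[of "rank_one h y" h] by (simp add: rank_one.rep_eq power2_norm_eq_inner [symmetric] power2_eq_square)
  then show "norm h * norm y \<le> norm (rank_one h y)"
    by (cases "h = 0") (auto simp: ac_simps)
qed

lemma norm_le_finite_rank_norm: "T \<in> finite_rank \<Longrightarrow> norm T \<le> finite_rank_norm T"
  unfolding finite_rank_norm_def
  by (rule cInf_greatest) (auto simp: finite_rank_def intro: norm_le_gauss_norm)

lemma finite_rank_norm_le: "finite_rank_repr n e x T \<Longrightarrow> finite_rank_norm T \<le> gauss_norm n x"
  unfolding finite_rank_norm_def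
  by (rule cInf_lower) (auto intro!: bdd_belowI[of _ 0] gauss_norm_nonneg)

lemma gauss_norm_Suc_0: "gauss_norm (Suc 0) x = norm (x 0)"
proof -
  have "(\<integral>\<gamma>. (norm (\<gamma> 0 *\<^sub>R x 0))\<^sup>2 \<partial>gauss_product 1) = (norm (x 0))\<^sup>2"
    using gauss_product_second_moment(2)[of 1 "\<lambda>k. norm (x 0)"] by (simp add: power_mult_distrib)
  then show ?thesis by (simp add: gauss_norm_def)
qed

text \<open>The operator norm bounds the infimum over all representations from below, and a
  representation with at most one term attains it.\<close>

lemma rank_one_finite_rank:
  shows "rank_one h y \<in> finite_rank" "finite_rank_norm (rank_one h y) = norm h * norm y"
proof -
  obtain n e x where r: "finite_rank_repr n e x (rank_one h y)" "gauss_norm n x = norm h * norm y"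
  \<comment> \<open>A one-term representation requires a unit vector, so \<open>h = 0\<close> is
    represented by the empty sum.\<close>
  proof (cases "h = 0")
    case True
    then show ?thesis
      by (intro that[of 0 "\<lambda>_. 0" "\<lambda>_. 0"])
        (auto simp: finite_rank_repr_def gauss_norm_def rank_one.rep_eq intro!: blinfun_eqI)
  next
    case False
    then show ?thesis
      by (intro that[of 1 "\<lambda>_. h /\<^sub>R norm h" "\<lambda>_. norm h *\<^sub>R y"])
        (auto simp: finite_rank_repr_def gauss_norm_Suc_0 rank_one.rep_eq power2_norm_eq_inner [symmetric]
          power2_eq_square intro!: blinfun_eqI)
  qed
  show "rank_one h y \<in> finite_rank" using r(1) by (auto simp: finite_rank_def)
  from norm_le_finite_rank_norm[OF this] finite_rank_norm_le[OF r(1)] r(2)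
  show "finite_rank_norm (rank_one h y) = norm h * norm y" by (simp add: norm_rank_one)
qed

text \<open>Operators with a common vector \<open>y\<close> differ by a rank-one operator, so that
  gamma norms of differences stay explicit when operators are approximated.\<close>

lemma rank_one_diff_left: "rank_one (h - g) y = rank_one h y - rank_one g y"
  by (rule blinfun_eqI) (simp add: rank_one.rep_eq blinfun.diff_left inner_diff_right algebra_simps)

text \<open>The constant sequence is admissible and produces the value. No admissible sequence
  produces less: its operator norms converge to that of the limit and are dominated by its finite
  rank norms.\<close>

lemma rank_one_gamma:
  shows "rank_one h y \<in> gamma_space" "gamma_norm (rank_one h y) = norm h * norm y"
proof -
  \<comment> \<open>The Cauchy condition of the constant sequence concerns
    \<open>finite_rank_norm 0\<close>, an infimum whose value must first be found.\<close>
  have "finite_rank_norm (0 :: 'a \<Rightarrow>\<^sub>L 'b) = 0"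
    using rank_one_finite_rank(2)[of "0 :: 'a" "0 :: 'b"] rank_one_diff_left[of "0 :: 'a" 0 "0 :: 'b"]
    by simp
  then have const: "gamma_approx (\<lambda>_. rank_one h y) (rank_one h y)"
    by (simp add: gamma_approx_def rank_one_finite_rank)
  then show "rank_one h y \<in> gamma_space" by (auto simp: gamma_space_def)
  have low: "norm h * norm y \<le> c"
    if "gamma_approx S (rank_one h y)" "(\<lambda>i. finite_rank_norm (S i)) \<longlonglongrightarrow> c" for S c
  proof -
    have "norm (rank_one h y) \<le> c"
      using that norm_le_finite_rank_norm
      by (intro LIMSEQ_le[OF tendsto_norm that(2)]) (auto simp: gamma_approx_def)
    then show ?thesis by (simp add: norm_rank_one)
  qed
  show "gamma_norm (rank_one h y) = norm h * norm y"
    unfolding gamma_norm_def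
  proof (rule cInf_eq_minimum)
    show "norm h * norm y \<in> {c. \<exists>S. gamma_approx S (rank_one h y) \<and> (\<lambda>i. finite_rank_norm (S i)) \<longlonglongrightarrow> c}"
      using const by (auto simp: rank_one_finite_rank intro!: exI[of _ "\<lambda>_. rank_one h y"])
  qed (use low in auto)
qed
subsection \<open>Radial integrals and power weights\<close>

text \<open>Up to the factor \<^term>\<open>unit_ball_vol\<close>, \<open>|x|\<^sup>d\<close> pushes Lebesgue measure forward to Lebesgue
  measure on the half line; using it as the radial variable removes the dimension from the
  exponents.\<close>

abbreviation radial_vol :: "'a::euclidean_space \<Rightarrow> real" where
  "radial_vol x \<equiv> norm x powr DIM('a)"

abbreviation ball_const :: "'a::euclidean_space itself \<Rightarrow> real" where
  "ball_const _ \<equiv> unit_ball_vol (real DIM('a))"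

lemma radial_vol_le_iff:
  fixes x :: "'a::euclidean_space"
  assumes "0 \<le> r"
  shows "radial_vol x \<le> r \<longleftrightarrow> norm x \<le> r powr (1 / DIM('a))"
proof -
  have "radial_vol x \<le> r \<longleftrightarrow> radial_vol x \<le> (r powr (1 / DIM('a))) powr DIM('a)"
    using assms by (simp add: powr_powr)
  also have "\<dots> \<longleftrightarrow> norm x \<le> r powr (1 / DIM('a))"
    using powr_mono2[of "DIM('a)" "norm x" "r powr (1 / DIM('a))"]
      powr_less_mono2[of "DIM('a)" "r powr (1 / DIM('a))" "norm x"]
    by (simp add: linorder_not_le [symmetric]) (metis linorder_not_le)
  finally show ?thesis .
qed

lemma radial_vol_level_emeasure:
  assumes "0 \<le> r"
  shows "emeasure lborel {x :: 'a::euclidean_space. radial_vol x \<le> r} = ennreal (ball_const TYPE('a) * r)"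
proof -
  have "{x :: 'a. radial_vol x \<le> r} = cball 0 (r powr (1 / DIM('a)))"
    by (simp add: set_eq_iff radial_vol_le_iff[OF assms])
  moreover have "(r powr (1 / DIM('a))) ^ DIM('a) = r"
  proof (cases "r = 0")
    case False
    then have "(r powr (1 / DIM('a))) ^ DIM('a) = (r powr (1 / DIM('a))) powr DIM('a)"
      using assms by (subst powr_realpow) auto
    also have "\<dots> = r" using assms by (simp add: powr_powr)
    finally show ?thesis .
  qed simp
  ultimately show ?thesis by (simp add: emeasure_cball)
qed

text \<open>The half lines \<open>{..a}\<close> form an intersection-stable generator. The preimage
  of one with \<open>a \<ge> 0\<close> is a ball whose volume is linear in \<open>a\<close>, which
  is the mass that the constant density assigns.\<close>

lemma distr_radial_vol:
  "distr lborel borel (radial_vol :: 'a::euclidean_space \<Rightarrow> real)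
    = density lborel (\<lambda>r. ennreal (ball_const TYPE('a)) * indicator {0..} r)" (is "?M = ?N")
proof (rule measure_eqI_generator_eq)
  let ?E = "range (\<lambda>a::real. {..a})"
  show "Int_stable ?E"
    by (auto simp: Int_stable_def)
  show "sets ?M = sigma_sets UNIV ?E" "sets ?N = sigma_sets UNIV ?E"
    by (simp_all add: borel_eq_atMost)
  have M: "emeasure ?M {..a} = ennreal (ball_const TYPE('a) * max a 0)" for a
  proof (cases "a \<ge> 0")
    case True
    then show ?thesis
      by (subst emeasure_distr) (auto simp: radial_vol_level_emeasure vimage_def)
  next
    case False
    then have "\<not> radial_vol x \<le> a" for x :: 'a
      using powr_ge_zero[of "norm x" "DIM('a)"] by linarith
    with False show ?thesis by (subst emeasure_distr) (auto simp: vimage_def)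
  qed
  show "emeasure ?M X = emeasure ?N X" if X: "X \<in> ?E" for X
  proof -
    obtain a where a: "X = {..a}" using X by auto
    have "emeasure ?N X = (\<integral>\<^sup>+r. ennreal (ball_const TYPE('a)) * indicator {0..a} r \<partial>lborel)"
      unfolding a by (subst emeasure_density) (auto intro!: nn_integral_cong split: split_indicator)
    also have "\<dots> = ennreal (ball_const TYPE('a)) * emeasure lborel {0..a}"
      by (intro nn_integral_cmult_indicator) auto
    also have "emeasure lborel {0..a} = ennreal (max a 0)"
      by (cases "0 \<le> a") (auto simp: max_absorb1 max_absorb2)
    finally show ?thesis by (simp add: a M ennreal_mult)
  qed
  show "range (\<lambda>i. {..real i}) \<subseteq> ?E" by auto
  show "(\<Union>i. {..real i}) = UNIV" by (auto intro: real_arch_simple)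
  show "emeasure ?M {..real i} \<noteq> \<infinity>" for i by (simp add: M)
qed auto

lemma nn_integral_radial:
  fixes f :: "real \<Rightarrow> ennreal"
  assumes [measurable]: "f \<in> borel_measurable borel"
  shows "(\<integral>\<^sup>+x. f (radial_vol x) \<partial>(lebesgue :: 'a::euclidean_space measure))
    = ball_const TYPE('a) * (\<integral>\<^sup>+r\<in>{0..}. f r \<partial>lborel)"
proof -
  have "(\<integral>\<^sup>+x. f (radial_vol x) \<partial>(lebesgue :: 'a measure)) = (\<integral>\<^sup>+r. f r \<partial>distr lborel borel (radial_vol :: 'a \<Rightarrow> real))"
    by (subst nn_integral_distr) (auto simp: nn_integral_completion)
  also have "\<dots> = (\<integral>\<^sup>+r. ennreal (ball_const TYPE('a)) * (f r * indicator {0..} r) \<partial>lborel)"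
    unfolding distr_radial_vol by (subst nn_integral_density) (auto simp: ac_simps)
  finally show ?thesis by (subst (asm) nn_integral_cmult) auto
qed

lemma nn_integral_radial_powr:
  assumes "-1 < a" "0 \<le> M"
  shows "(\<integral>\<^sup>+x. ennreal (radial_vol x powr a) * indicator {..M} (radial_vol x) \<partial>(lebesgue :: 'a::euclidean_space measure))
    = ennreal (ball_const TYPE('a) * (M powr (a + 1) / (a + 1)))"
proof -
  have "(\<integral>\<^sup>+x. ennreal (radial_vol x powr a) * indicator {..M} (radial_vol x) \<partial>(lebesgue :: 'a measure))
    = ball_const TYPE('a) * (\<integral>\<^sup>+r. ennreal (r powr a) * indicator {0..M} r \<partial>lborel)"
  proof (subst nn_integral_radial[of "\<lambda>r. ennreal (r powr a) * indicator {..M} r"])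
    have "(\<integral>\<^sup>+r\<in>{0..}. (ennreal (r powr a) * indicator {..M} r) \<partial>lborel)
      = (\<integral>\<^sup>+r. ennreal (r powr a) * indicator {0..M} r \<partial>lborel)"
      by (intro nn_integral_cong) (auto split: split_indicator)
    then show "ennreal (ball_const TYPE('a)) * (\<integral>\<^sup>+r\<in>{0..}. (ennreal (r powr a) * indicator {..M} r) \<partial>lborel)
      = ennreal (ball_const TYPE('a)) * (\<integral>\<^sup>+r. ennreal (r powr a) * indicator {0..M} r \<partial>lborel)"
      by (rule arg_cong)
  qed simp
  also have "(\<integral>\<^sup>+r. ennreal (r powr a) * indicator {0..M} r \<partial>lborel) = ennreal (M powr (a + 1) / (a + 1))"
    using assms by (intro nn_integral_has_integral_lebesgue' has_integral_powr_from_0) auto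
  finally show ?thesis using assms by (subst ennreal_mult) auto
qed

lemma AE_lebesgue_neq: "AE x in lebesgue. x \<noteq> (c :: 'a::euclidean_space)"
  by (rule AE_completion) (rule AE_lborel_singleton)

text \<open>A weight must be positive everywhere, hence the value \<open>1\<close> at the origin.\<close>

definition power_weight :: "real \<Rightarrow> 'a::euclidean_space \<Rightarrow> real" where
  "power_weight a x = (if x = 0 then 1 else radial_vol x powr a)"

lemma power_weight_pos: "0 < power_weight a x"
  by (simp add: power_weight_def)

lemma power_weight_powr: "power_weight a x powr b = power_weight (a * b) x"
  by (simp add: power_weight_def powr_powr mult.assoc)

lemma borel_measurable_power_weight [measurable]: "power_weight a \<in> borel_measurable borel"
  unfolding power_weight_def [abs_def] by measurable

lemma nn_integral_power_weight_ball:
  assumes "-1 < a" "0 \<le> R"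
  shows "(\<integral>\<^sup>+x\<in>cball 0 R. ennreal (power_weight a x) \<partial>(lebesgue :: 'a::euclidean_space measure))
    = ennreal (ball_const TYPE('a) * ((R powr DIM('a)) powr (a + 1) / (a + 1)))"
proof -
  have "(\<integral>\<^sup>+x\<in>cball 0 R. ennreal (power_weight a x) \<partial>(lebesgue :: 'a measure))
    = (\<integral>\<^sup>+x. ennreal (radial_vol x powr a) * indicator {..R powr DIM('a)} (radial_vol x) \<partial>(lebesgue :: 'a measure))"
  proof (rule nn_integral_cong_AE, use AE_lebesgue_neq[of 0] in eventually_elim)
    fix x :: 'a assume "x \<noteq> 0"
    moreover have "radial_vol x \<le> R powr DIM('a) \<longleftrightarrow> norm x \<le> R"
      using radial_vol_le_iff[of "R powr DIM('a)" x] assms by (simp add: powr_powr)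
    ultimately show "ennreal (power_weight a x) * indicator (cball 0 R) x
      = ennreal (radial_vol x powr a) * indicator {..R powr DIM('a)} (radial_vol x)"
      by (simp add: power_weight_def indicator_def)
  qed
  also have "\<dots> = ennreal (ball_const TYPE('a) * ((R powr DIM('a)) powr (a + 1) / (a + 1)))"
    using assms by (intro nn_integral_radial_powr) auto
  finally show ?thesis .
qed

lemma weight_power_weight:
  assumes "-1 < a"
  shows "weight (power_weight a :: 'a::euclidean_space \<Rightarrow> real)"
  unfolding weight_def
proof (intro conjI allI impI)
  fix S :: "'a set" assume S: "compact S"
  then obtain R where R: "R > 0" "S \<subseteq> cball 0 R"
    using compact_imp_bounded[OF S] bounded_pos by (metis mem_cball_0 subsetI)
  have [measurable]: "S \<in> sets borel" using S by (simp add: borel_compact)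
  show "(power_weight a :: 'a \<Rightarrow> real) absolutely_integrable_on S"
    unfolding set_integrable_def
  proof (rule integrableI_bounded)
    show "(\<lambda>x. indicator S x *\<^sub>R power_weight a x) \<in> borel_measurable lebesgue"
      by (rule measurable_completion) simp
    have "(\<integral>\<^sup>+x. ennreal (norm (indicator S x *\<^sub>R power_weight a x)) \<partial>lebesgue)
      \<le> (\<integral>\<^sup>+x\<in>cball (0 :: 'a) R. ennreal (power_weight a x) \<partial>lebesgue)"
      using R(2)
      by (intro nn_integral_mono) (auto split: split_indicator simp: abs_of_pos power_weight_pos)
    also have "\<dots> < \<infinity>" using assms R by (simp add: nn_integral_power_weight_ball)
    finally show "(\<integral>\<^sup>+x. ennreal (norm (indicator S x *\<^sub>R power_weight a x)) \<partial>lebesgue) < \<infinity>" .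
  qed
qed (rule power_weight_pos)

section \<open>Muckenhoupt constants of power weights\<close>

lemma emeasure_cube:
  assumes "l > 0"
  shows "emeasure lebesgue (cbox c (c + l *\<^sub>R One) :: 'a::euclidean_space set) = ennreal (l powr DIM('a))"
proof -
  have "emeasure lborel (cbox c (c + l *\<^sub>R One) :: 'a set) = ennreal (\<Prod>b\<in>(Basis :: 'a set). l)"
    using assms by (subst emeasure_lborel_cbox) (auto simp: inner_add_left)
  then show ?thesis using assms by (simp add: powr_realpow)
qed

text \<open>The origin is exempt because of the artificial value of \<open>power_weight\<close>
  there; one point does not affect the average.\<close>

lemma average_le_const:
  fixes g :: "'a::euclidean_space \<Rightarrow> real"
  assumes "Q \<in> cubes" "\<And>x. x \<in> Q \<Longrightarrow> x \<noteq> 0 \<Longrightarrow> g x \<le> B"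
  shows "average Q g \<le> ennreal B"
proof -
  obtain c l where Q: "Q = cbox c (c + l *\<^sub>R One)" "l > 0" using assms(1) by (auto simp: cubes_def)
  then have eQ: "emeasure lebesgue Q = ennreal (l powr DIM('a))" by (simp only: emeasure_cube)
  have "(\<integral>\<^sup>+x\<in>Q. ennreal (g x) \<partial>lebesgue) \<le> (\<integral>\<^sup>+x. ennreal B * indicator Q x \<partial>lebesgue)"
  proof (rule nn_integral_mono_AE, use AE_lebesgue_neq[of 0] in eventually_elim)
    fix x :: 'a assume "x \<noteq> 0"
    then show "ennreal (g x) * indicator Q x \<le> ennreal B * indicator Q x"
      using assms(2)[of x] by (auto split: split_indicator intro: ennreal_leI)
  qed
  also have "\<dots> = ennreal B * emeasure lebesgue Q"
    using Q by (intro nn_integral_cmult_indicator) auto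
  finally have "average Q g \<le> ennreal B * emeasure lebesgue Q / emeasure lebesgue Q"
    unfolding average_def by (rule divide_right_mono_ennreal)
  also have "\<dots> = ennreal B"
    unfolding eQ using Q(2) by (simp add: ennreal_mult_divide_eq)
  finally show ?thesis .
qed

lemma cube_radius:
  assumes "x \<in> cbox c (c + l *\<^sub>R One :: 'a::euclidean_space)"
  shows "norm (x - c) \<le> l * DIM('a)"
proof -
  have "norm (x - c) \<le> (\<Sum>b\<in>Basis. \<bar>(x - c) \<bullet> b\<bar>)" by (rule norm_le_l1)
  also have "\<dots> \<le> (\<Sum>b\<in>(Basis :: 'a set). l)"
  proof (rule sum_mono)
    fix b :: 'a assume "b \<in> Basis"
    then show "\<bar>(x - c) \<bullet> b\<bar> \<le> l"
      using assms by (auto simp: mem_box inner_diff_left inner_add_left)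
  qed
  finally show ?thesis by (simp add: mult.commute)
qed

text \<open>The summands are the constants for cubes far from the origin and for cubes close to it,
  relative to their side length.\<close>

definition cube_const :: "'a::euclidean_space itself \<Rightarrow> real" where
  "cube_const _ = 2 powr DIM('a) + ball_const TYPE('a) * (4 * DIM('a)) powr DIM('a)"

lemma cube_const_pos: "0 < cube_const TYPE('a::euclidean_space)"
  by (simp add: cube_const_def add_pos_nonneg)

text \<open>On a cube far from the origin all norms are comparable to \<open>R\<close>, so the
  weight is nearly constant. A cube close to the origin is compared with the ball of radius
  \<open>R\<close>, whose volume is at most a fixed multiple of that of the cube. The explicit
  integral over the ball brings in the factor \<open>1 / (a + 1)\<close>, which becomes
  \<open>1 / \<delta>\<close> for \<open>a = \<delta> - 1\<close>.\<close>

lemma average_power_weight_nonpos: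
  fixes c :: "'a::euclidean_space" and a l :: real
  assumes "-1 < a" "a \<le> 0" "l > 0"
  defines "R \<equiv> norm c + l * DIM('a)"
  shows "average (cbox c (c + l *\<^sub>R One)) (power_weight a)
    \<le> ennreal (cube_const TYPE('a) / (a + 1) * (R powr DIM('a)) powr a)"
proof -
  let ?Q = "cbox c (c + l *\<^sub>R One)" and ?d = "real DIM('a)"
  have d: "?d \<ge> 1" using DIM_positive[where 'a = 'a] by linarith
  have R: "R > 0" using assms(3) d by (simp add: R_def add_nonneg_pos)
  have Q: "?Q \<in> cubes" using assms(3) by (auto simp: cubes_def)
  show ?thesis
  \<comment> \<open>The factor 3 is where \<open>norm c - l * ?d\<close>, a lower bound for the norm
    on the cube, reaches \<open>R / 2\<close>. Below the threshold \<open>R\<close> is at most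
    \<open>4 * ?d * l\<close>.\<close>
  proof (cases "norm c \<ge> 3 * (l * ?d)")
    case True
    have "average ?Q (power_weight a) \<le> ennreal (2 powr ?d * (R powr ?d) powr a)"
    proof (rule average_le_const[OF Q])
      fix x :: 'a assume x: "x \<in> ?Q" "x \<noteq> 0"
      have "norm c - norm x \<le> l * ?d"
        using cube_radius[OF x(1)] norm_triangle_ineq2[of c x] by (simp add: norm_minus_commute)
      with True have le: "R / 2 \<le> norm x" by (simp add: R_def)
      have "radial_vol x powr a \<le> ((R / 2) powr ?d) powr a"
      proof (rule powr_mono2')
        show "0 < (R / 2) powr ?d" using R by simp
        show "(R / 2) powr ?d \<le> radial_vol x" using R le by (intro powr_mono2) auto
      qed fact
      then have "power_weight a x \<le> ((R / 2) powr ?d) powr a"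
        using x(2) by (simp add: power_weight_def)
      also have "\<dots> = 2 powr (?d * - a) * (R powr ?d) powr a"
        using R by (simp add: powr_divide powr_powr powr_minus divide_simps)
      also have "\<dots> \<le> 2 powr ?d * (R powr ?d) powr a"
        using assms(1) d mult_left_mono[of "- a" 1 ?d] by (intro mult_right_mono powr_mono) auto
      finally show "power_weight a x \<le> 2 powr ?d * (R powr ?d) powr a" .
    qed
    also have "\<dots> \<le> ennreal (cube_const TYPE('a) / (a + 1) * (R powr ?d) powr a)"
    proof (intro ennreal_leI mult_right_mono)
      have "2 powr ?d \<le> cube_const TYPE('a)" by (simp add: cube_const_def)
      also have "\<dots> \<le> cube_const TYPE('a) / (a + 1)"
        using assms(1,2) cube_const_pos[where 'a = 'a] by (simp add: pos_le_divide_eq mult_le_cancel_left1)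
      finally show "2 powr ?d \<le> cube_const TYPE('a) / (a + 1)" .
    qed simp
    finally show ?thesis .
  next
    case False
    then have lt: "R \<le> 4 * ?d * l" by (simp add: R_def)
    have sub: "?Q \<subseteq> cball 0 R"
    proof
      fix x :: 'a assume "x \<in> ?Q"
      then show "x \<in> cball 0 R"
        using cube_radius[of x c l] norm_triangle_sub[of x c] by (simp add: R_def)
    qed
    have "(\<integral>\<^sup>+x\<in>?Q. ennreal (power_weight a x) \<partial>lebesgue)
        \<le> (\<integral>\<^sup>+x\<in>cball (0 :: 'a) R. ennreal (power_weight a x) \<partial>lebesgue)"
      using sub by (intro nn_integral_mono) (auto split: split_indicator)
    also have "\<dots> = ennreal (ball_const TYPE('a) * ((R powr ?d) powr (a + 1) / (a + 1)))"
      using assms(1) R by (intro nn_integral_power_weight_ball) auto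
    finally have "average ?Q (power_weight a)
      \<le> ennreal (ball_const TYPE('a) * ((R powr ?d) powr (a + 1) / (a + 1))) / ennreal (l powr ?d)"
      unfolding average_def emeasure_cube[OF assms(3)] by (rule divide_right_mono_ennreal)
    also have "\<dots> = ennreal (ball_const TYPE('a) * ((R powr ?d) powr (a + 1) / (a + 1)) / l powr ?d)"
      using assms(1,3) by (intro divide_ennreal) auto
    also have "\<dots> \<le> ennreal (cube_const TYPE('a) / (a + 1) * (R powr ?d) powr a)"
    proof (rule ennreal_leI)
      have "R powr ?d \<le> (4 * ?d * l) powr ?d" using lt R by (intro powr_mono2) auto
      also have "\<dots> = (4 * ?d) powr ?d * l powr ?d" using assms(3) by (simp add: powr_mult)
      finally have *: "R powr ?d / l powr ?d \<le> (4 * ?d) powr ?d"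
        using assms(3) by (simp add: divide_simps)
      have "ball_const TYPE('a) * ((R powr ?d) powr (a + 1) / (a + 1)) / l powr ?d
          = ball_const TYPE('a) * (R powr ?d / l powr ?d) / (a + 1) * (R powr ?d) powr a"
        using R by (simp add: powr_add ac_simps)
      also have "\<dots> \<le> ball_const TYPE('a) * (4 * ?d) powr ?d / (a + 1) * (R powr ?d) powr a"
        using * assms(1) by (intro mult_right_mono divide_right_mono mult_left_mono) auto
      also have "\<dots> \<le> cube_const TYPE('a) / (a + 1) * (R powr ?d) powr a"
        using assms(1) by (intro mult_right_mono divide_right_mono) (auto simp: cube_const_def)
      finally show "ball_const TYPE('a) * ((R powr ?d) powr (a + 1) / (a + 1)) / l powr ?d
        \<le> cube_const TYPE('a) / (a + 1) * (R powr ?d) powr a" .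
    qed
    finally show ?thesis .
  qed
qed

lemma average_power_weight_nonneg:
  fixes c :: "'a::euclidean_space"
  assumes "0 \<le> a" "l > 0"
  shows "average (cbox c (c + l *\<^sub>R One)) (power_weight a)
    \<le> ennreal (((norm c + l * DIM('a)) powr DIM('a)) powr a)"
proof (rule average_le_const)
  fix x :: 'a assume x: "x \<in> cbox c (c + l *\<^sub>R One)" "x \<noteq> 0"
  then have "norm x \<le> norm c + l * DIM('a)"
    using cube_radius[OF x(1)] norm_triangle_sub[of x c] by simp
  then show "power_weight a x \<le> ((norm c + l * DIM('a)) powr DIM('a)) powr a"
    using x assms by (auto simp: power_weight_def intro!: powr_mono2)
qed (use assms in \<open>auto simp: cubes_def\<close>)

lemma ennpowr_le:
  assumes "x \<le> ennreal c" "0 \<le> c" "0 \<le> a"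
  shows "ennpowr x a \<le> ennreal (c powr a)"
proof -
  have "enn2real x \<le> c"
    using enn2real_mono[OF assms(1)] assms(2) by simp
  moreover have "x \<noteq> \<top>" using assms(1) by (auto simp: top_unique)
  ultimately show ?thesis
    using assms(3) by (auto simp: ennpowr_def intro!: ennreal_leI powr_mono2)
qed

text \<open>The relation between the exponents says that \<open>a2\<close> belongs to the dual
  weight of \<open>a1\<close>. Both averages are measured against the same radius, so its powers
  cancel and a bound uniform in the cube remains.\<close>

lemma Ap_const_power_weight_le:
  assumes q: "1 < q" and b: "0 \<le> B1" "0 \<le> B2" "a1 + a2 * (q - 1) = 0"
    and 1: "\<And>c l. l > 0 \<Longrightarrow> average (cbox c (c + l *\<^sub>R One)) (power_weight a1 :: 'a::euclidean_space \<Rightarrow> real)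
      \<le> ennreal (B1 * ((norm c + l * DIM('a)) powr DIM('a)) powr a1)"
    and 2: "\<And>c l. l > 0 \<Longrightarrow> average (cbox c (c + l *\<^sub>R One)) (power_weight a2 :: 'a \<Rightarrow> real)
      \<le> ennreal (B2 * ((norm c + l * DIM('a)) powr DIM('a)) powr a2)"
  shows "Ap_const q (power_weight a1 :: 'a \<Rightarrow> real) \<le> ennreal (B1 * B2 powr (q - 1))"
  unfolding Ap_const_def
proof (rule SUP_least)
  fix Q :: "'a set" assume "Q \<in> cubes"
  then obtain c l where Q: "Q = cbox c (c + l *\<^sub>R One)" "l > 0" by (auto simp: cubes_def)
  define M where "M = (norm c + l * DIM('a)) powr DIM('a)"
  have "0 < norm c + l * DIM('a)" using Q(2) by (intro add_nonneg_pos) auto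
  then have M: "M > 0" by (simp add: M_def)
  have "a1 * (1 - q / (q - 1)) = a2"
    using q b(3) by (simp add: field_simps)
  then have dual: "(\<lambda>x :: 'a. power_weight a1 x powr (1 - q / (q - 1))) = power_weight a2"
    by (simp add: power_weight_powr fun_eq_iff)
  have "average Q (power_weight a1) * ennpowr (average Q (power_weight a2)) (q - 1)
     \<le> ennreal (B1 * M powr a1) * ennreal ((B2 * M powr a2) powr (q - 1))"
    using 1[OF Q(2)] 2[OF Q(2)] q b unfolding Q(1) M_def by (intro mult_mono ennpowr_le) auto
  also have "\<dots> = ennreal (B1 * B2 powr (q - 1) * (M powr a1 * (M powr a2) powr (q - 1)))"
    using b by (simp add: ennreal_mult [symmetric] powr_mult ac_simps)
  also have "M powr a1 * (M powr a2) powr (q - 1) = 1"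
    using M b(3) by (simp add: powr_powr powr_add [symmetric])
  finally show "average Q (power_weight a1) * ennpowr (average Q (\<lambda>x. power_weight a1 x powr (1 - q / (q - 1)))) (q - 1)
     \<le> ennreal (B1 * B2 powr (q - 1))"
    unfolding dual by simp
qed

text \<open>In each case one of the weight and its dual has the singular exponent
  \<open>\<delta> - 1\<close> and contributes \<open>cube_const / \<delta>\<close>, while the other
  has a nonnegative exponent and contributes the constant 1. If the dual is the singular one, its
  average enters with the power \<open>q - 1\<close>.\<close>

lemma
  assumes q: "1 < q" and \<delta>: "0 < \<delta>" "\<delta> \<le> 1"
  shows power_weight_Ap_class: "power_weight (\<delta> - 1) \<in> (Ap_class q :: ('a::euclidean_space \<Rightarrow> real) set)"
      "power_weight ((1 - \<delta>) * (q - 1)) \<in> (Ap_class q :: ('a \<Rightarrow> real) set)"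
    and Ap_const_power_weight: "Ap_const q (power_weight (\<delta> - 1) :: 'a \<Rightarrow> real) \<le> ennreal (cube_const TYPE('a) / \<delta>)"
      "Ap_const q (power_weight ((1 - \<delta>) * (q - 1)) :: 'a \<Rightarrow> real) \<le> ennreal ((cube_const TYPE('a) / \<delta>) powr (q - 1))"
proof -
  have b: "0 \<le> (1 - \<delta>) * (q - 1)" using q \<delta> by simp
  show 1: "Ap_const q (power_weight (\<delta> - 1) :: 'a \<Rightarrow> real) \<le> ennreal (cube_const TYPE('a) / \<delta>)"
    using Ap_const_power_weight_le[of q "cube_const TYPE('a) / \<delta>" 1 "\<delta> - 1" "(1 - \<delta>) / (q - 1)", where 'a = 'a]
      average_power_weight_nonpos[of "\<delta> - 1", where 'a = 'a]
      average_power_weight_nonneg[of "(1 - \<delta>) / (q - 1)", where 'a = 'a] q \<delta> cube_const_pos[where 'a = 'a]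
    by simp
  show 2: "Ap_const q (power_weight ((1 - \<delta>) * (q - 1)) :: 'a \<Rightarrow> real) \<le> ennreal ((cube_const TYPE('a) / \<delta>) powr (q - 1))"
    using Ap_const_power_weight_le[of q 1 "cube_const TYPE('a) / \<delta>" "(1 - \<delta>) * (q - 1)" "\<delta> - 1", where 'a = 'a]
      average_power_weight_nonpos[of "\<delta> - 1", where 'a = 'a]
      average_power_weight_nonneg[OF b, where 'a = 'a] q \<delta> cube_const_pos[where 'a = 'a]
    by (simp add: distrib_right [symmetric])
  have "-1 < (1 - \<delta>) * (q - 1)" using b by linarith
  then show "power_weight (\<delta> - 1) \<in> (Ap_class q :: ('a::euclidean_space \<Rightarrow> real) set)"
      "power_weight ((1 - \<delta>) * (q - 1)) \<in> (Ap_class q :: ('a \<Rightarrow> real) set)"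
    using \<delta> le_less_trans[OF 1] le_less_trans[OF 2] by (auto simp: Ap_class_def intro!: weight_power_weight)
qed
subsection \<open>Operators represented by scalar functions\<close>

lemma abs_L2_eqI: "L2_eq f g \<Longrightarrow> abs_L2 f = abs_L2 g"
  by (rule Quotient_rel_abs[OF Quotient_L2])

lemma norm_abs_L2:
  assumes "square_integrable h"
  shows "norm (abs_L2 h) = sqrt (\<integral>t. (h t)\<^sup>2 \<partial>lebesgue)"
  using assms by (simp add: norm_L2_def inner_L2.abs_eq L2_eq_def power2_eq_square)

lemma square_integrable_bounded_mult:
  assumes h: "square_integrable h" and k: "k \<in> borel_measurable lebesgue"
    and b: "AE t in lebesgue. \<bar>k t\<bar> \<le> B"
  shows "square_integrable (\<lambda>t. k t * h t)"
    and "(\<integral>t. (k t * h t)\<^sup>2 \<partial>lebesgue) \<le> B\<^sup>2 * (\<integral>t. (h t)\<^sup>2 \<partial>lebesgue)"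
proof -
  have le: "AE t in lebesgue. (k t * h t)\<^sup>2 \<le> B\<^sup>2 * (h t)\<^sup>2"
    using b by eventually_elim (auto simp: power_mult_distrib abs_le_square_iff [symmetric] intro: mult_right_mono)
  have int: "integrable lebesgue (\<lambda>t. B\<^sup>2 * (h t)\<^sup>2)"
    using h by (simp add: square_integrable_def)
  have [measurable]: "h \<in> borel_measurable lebesgue" using h by (simp add: square_integrable_def)
  have "integrable lebesgue (\<lambda>t. (k t * h t)\<^sup>2)"
  proof (rule Bochner_Integration.integrable_bound[OF int])
    show "(\<lambda>t. (k t * h t)\<^sup>2) \<in> borel_measurable lebesgue" using k by measurable
    show "AE t in lebesgue. norm ((k t * h t)\<^sup>2) \<le> norm (B\<^sup>2 * (h t)\<^sup>2)"
      using le by eventually_elim simp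
  qed
  moreover have "(\<lambda>t. k t * h t) \<in> borel_measurable lebesgue" using k by measurable
  ultimately show "square_integrable (\<lambda>t. k t * h t)" by (simp add: square_integrable_def)
  show "(\<integral>t. (k t * h t)\<^sup>2 \<partial>lebesgue) \<le> B\<^sup>2 * (\<integral>t. (h t)\<^sup>2 \<partial>lebesgue)"
    using integral_mono_AE[OF \<open>integrable lebesgue (\<lambda>t. (k t * h t)\<^sup>2)\<close> int le] by simp
qed

lemma strongly_measurable_scaleR:
  assumes "h \<in> borel_measurable lebesgue"
  shows "strongly_measurable (\<lambda>t. h t *\<^sub>R y)"
proof -
  obtain F where F: "\<And>i. simple_function lebesgue (F i)" "\<And>x. (\<lambda>i. F i x) \<longlonglongrightarrow> h x"
    using borel_measurable_implies_sequence_metric[OF assms, of 0] by auto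
  have "(\<lambda>i. norm (F i x *\<^sub>R y - h x *\<^sub>R y)) \<longlonglongrightarrow> 0" for x
  proof -
    have "(\<lambda>i. F i x *\<^sub>R y - h x *\<^sub>R y) \<longlonglongrightarrow> h x *\<^sub>R y - h x *\<^sub>R y"
      by (intro tendsto_intros F(2))
    then show ?thesis by (simp add: tendsto_norm_zero_iff)
  qed
  then show ?thesis
    using F(1) unfolding strongly_measurable_in_def
    by (intro conjI exI[of _ "\<lambda>i x. F i x *\<^sub>R y"]) (auto intro: simple_function_compose1)
qed

text \<open>The function \<open>lim\<close> is measurable even where the sequence diverges, and
  completeness of \<open>lebesgue\<close> absorbs the exceptional null set.\<close>

lemma borel_measurable_functional:
  assumes "strongly_measurable f"
  shows "(\<lambda>t. blinfun_apply (\<xi> :: 'v::real_normed_vector \<Rightarrow>\<^sub>L real) (f t)) \<in> borel_measurable lebesgue"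
proof -
  obtain S where S: "\<And>i. simple_function lebesgue (S i)"
      "AE t in lebesgue. (\<lambda>i. norm (S i t - f t)) \<longlonglongrightarrow> 0"
    using assms by (auto simp: strongly_measurable_in_def)
  have [measurable]: "(\<lambda>t. blinfun_apply \<xi> (S i t)) \<in> borel_measurable lebesgue" for i
    by (rule borel_measurable_simple_function) (rule simple_function_compose1[OF S(1)])
  have "(\<lambda>t. lim (\<lambda>i. blinfun_apply \<xi> (S i t))) \<in> borel_measurable lebesgue" by measurable
  moreover have "AE t in lebesgue. lim (\<lambda>i. blinfun_apply \<xi> (S i t)) = blinfun_apply \<xi> (f t)"
    using S(2)
  proof eventually_elim
    fix t assume "(\<lambda>i. norm (S i t - f t)) \<longlonglongrightarrow> 0"
    then have "(\<lambda>i. S i t) \<longlonglongrightarrow> f t" by (simp add: tendsto_norm_zero_iff Lim_null [symmetric])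
    then have "(\<lambda>i. blinfun_apply \<xi> (S i t)) \<longlonglongrightarrow> blinfun_apply \<xi> (f t)"
      by (intro tendsto_intros)
    then show "lim (\<lambda>i. blinfun_apply \<xi> (S i t)) = blinfun_apply \<xi> (f t)" by (rule limI)
  qed
  ultimately show ?thesis by (rule borel_measurable_AE)
qed

text \<open>Representation is tested only through functionals, so uniqueness rests on their
  separating points. It is what gives the \<open>THE\<close> in \<open>fun_operator\<close> a
  value.\<close>

lemma represents_unique:
  fixes f :: "'a::euclidean_space \<Rightarrow> 'y::real_normed_vector"
  assumes "represents f T" "represents f T'"
  shows "T = T'"
proof (rule blinfun_eqI)
  fix x :: "'a L2"
  obtain \<phi> where \<phi>: "square_integrable \<phi>" "x = abs_L2 \<phi>"
    using Quotient_abs_rep[OF Quotient_L2, of x] Quotient_rep_reflp[OF Quotient_L2, of x]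
    by (metis L2_eq_def)
  show "blinfun_apply T x = blinfun_apply T' x"
    by (rule functionals_separate_points) (use assms \<phi> in \<open>simp add: represents_def\<close>)
qed

lemma represents_scalar:
  fixes y :: "'y::real_normed_vector"
  assumes h: "square_integrable (h :: 'a::euclidean_space \<Rightarrow> real)"
  shows "represents (\<lambda>t. h t *\<^sub>R y) (rank_one (abs_L2 h) y)"
  unfolding represents_def
proof (intro conjI allI impI)
  show "strongly_measurable (\<lambda>t. h t *\<^sub>R y)"
    using h by (intro strongly_measurable_scaleR) (simp add: square_integrable_def)
  fix y' :: "'y \<Rightarrow>\<^sub>L real"
  show "square_integrable (\<lambda>t. blinfun_apply y' (h t *\<^sub>R y))"
    using square_integrable_scale[OF h, of "blinfun_apply y' y"]
    by (simp add: blinfun.scaleR_right mult.commute)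
  fix \<phi> :: "'a \<Rightarrow> real" assume \<phi>: "square_integrable \<phi>"
  have "blinfun_apply y' (blinfun_apply (rank_one (abs_L2 h) y) (abs_L2 \<phi>))
    = (\<integral>t. \<phi> t * h t \<partial>lebesgue) * blinfun_apply y' y"
    using h \<phi> by (simp add: rank_one.rep_eq blinfun.scaleR_right inner_L2.abs_eq L2_eq_def)
  also have "\<dots> = (\<integral>t. (\<phi> t * h t) * blinfun_apply y' y \<partial>lebesgue)" by simp
  also have "\<dots> = (\<integral>t. blinfun_apply y' (h t *\<^sub>R y) * \<phi> t \<partial>lebesgue)"
    by (simp add: blinfun.scaleR_right ac_simps)
  finally show "blinfun_apply y' (blinfun_apply (rank_one (abs_L2 h) y) (abs_L2 \<phi>))
    = (\<integral>t. blinfun_apply y' (h t *\<^sub>R y) * \<phi> t \<partial>lebesgue)" .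
qed

lemma
  assumes "square_integrable h"
  shows gamma_function_scalar: "gamma_function (\<lambda>t. h t *\<^sub>R y)"
    and fun_operator_scalar: "fun_operator (\<lambda>t. h t *\<^sub>R y) = rank_one (abs_L2 h) y"
proof -
  note rep = represents_scalar[OF assms, of y]
  show "gamma_function (\<lambda>t. h t *\<^sub>R y)"
    unfolding gamma_function_def using rep rank_one_gamma(1) by blast
  show "fun_operator (\<lambda>t. h t *\<^sub>R y) = rank_one (abs_L2 h) y"
    unfolding fun_operator_def by (rule the_equality) (rule rep, rule represents_unique[OF _ rep])
qed

subsection \<open>The kernel\<close>

definition max_kernel :: "'a::euclidean_space \<Rightarrow> 'a \<Rightarrow> real" where
  "max_kernel s t = max (norm s) (norm t) powr (- (real DIM('a) / 2))"

definition rank_one_kernel ::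
    "('x::real_normed_vector \<Rightarrow>\<^sub>L real) \<Rightarrow> 'y::real_normed_vector \<Rightarrow> ('a::euclidean_space, 'x, 'y) kernel" where
  "rank_one_kernel \<xi> y s t = max_kernel s t *\<^sub>R (blinfun_scaleR_left y o\<^sub>L \<xi>)"

lemma rank_one_kernel_apply:
  "blinfun_apply (rank_one_kernel \<xi> y s t) x = (max_kernel s t * blinfun_apply \<xi> x) *\<^sub>R y"
  by (simp add: rank_one_kernel_def scaleR_blinfun.rep_eq)

lemma borel_measurable_max_kernel [measurable]: "max_kernel s \<in> borel_measurable borel"
  unfolding max_kernel_def [abs_def] by measurable

lemma strongly_measurable_rank_one_kernel:
  "strongly_measurable_kernel (rank_one_kernel \<xi> y :: ('a::euclidean_space, 'x::real_normed_vector, 'y::real_normed_vector) kernel)"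
  unfolding strongly_measurable_kernel_def
proof
  fix x
  have "(\<lambda>p :: 'a \<times> 'a. max_kernel (fst p) (snd p)) \<in> borel_measurable borel"
  proof -
    have [measurable]: "(\<lambda>p :: 'a \<times> 'a. max (norm (fst p)) (norm (snd p))) \<in> borel_measurable borel"
      by (intro borel_measurable_continuous_onI continuous_intros)
    show ?thesis unfolding max_kernel_def by measurable
  qed
  then have "(\<lambda>p :: 'a \<times> 'a. max_kernel (fst p) (snd p) * blinfun_apply \<xi> x) \<in> borel_measurable lebesgue"
    by (intro measurable_completion) simp
  from strongly_measurable_scaleR[OF this, of y]
  show "strongly_measurable (\<lambda>(s :: 'a, t). blinfun_apply (rank_one_kernel \<xi> y s t) x)"
    by (simp add: rank_one_kernel_apply case_prod_beta')
qed

section \<open>Dini regularity of the kernel\<close>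

lemma powr_minus_lipschitz:
  fixes a b c r :: real
  assumes "0 < r" "r \<le> a" "r \<le> b" "0 < c"
  shows "\<bar>a powr (- c) - b powr (- c)\<bar> \<le> c * r powr (- c - 1) * \<bar>a - b\<bar>"
  using assms
proof (induction a b rule: linorder_wlog)
  case (le a b)
  show ?case
  proof (cases "a = b")
    case False
    with le have "a < b" by simp
    have "\<exists>z. a < z \<and> z < b \<and> b powr (- c) - a powr (- c) = (b - a) * (- c * z powr (- c - 1))"
    proof (rule MVT2[OF \<open>a < b\<close>])
      fix x assume "a \<le> x"
      with le show "((\<lambda>x. x powr (- c)) has_real_derivative - c * x powr (- c - 1)) (at x)"
        by (intro has_real_derivative_powr) simp
    qed
    then obtain z where z: "a < z" "b powr (- c) - a powr (- c) = (b - a) * (- c * z powr (- c - 1))"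
      by blast
    have "z powr (- c - 1) \<le> r powr (- c - 1)"
      using le z by (intro powr_mono2') auto
    then have "(b - a) * (c * z powr (- c - 1)) \<le> (b - a) * (c * r powr (- c - 1))"
      using le by (intro mult_left_mono) auto
    moreover have "0 \<le> (b - a) * (c * z powr (- c - 1))" using le by simp
    ultimately show ?thesis using z(2) \<open>a < b\<close> by (simp add: algebra_simps)
  qed simp
next
  case (sym a b)
  then show ?case by (simp add: abs_minus_commute)
qed

text \<open>The larger of two norms is at least half the norm of the difference, so both maxima are
  at least \<open>r / 4\<close>. On that range the negative power is Lipschitz, and
  \<open>r / 4\<close> is the origin of the constant \<open>4 powr (c + 1)\<close>.\<close>

lemma max_kernel_lipschitz:
  fixes s t s' t' :: "'a::euclidean_space"
  assumes r: "0 < r" "norm (s - t) = r" and m: "\<bar>max (norm s) (norm t) - max (norm s') (norm t')\<bar> \<le> e"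
    and s't': "r / 2 \<le> norm (s' - t')"
  defines "c \<equiv> real DIM('a) / 2"
  shows "\<bar>max_kernel s t - max_kernel s' t'\<bar> \<le> c * 4 powr (c + 1) * (e / r) * r powr (- c)"
proof -
  have c: "0 < c" by (simp add: c_def)
  have "\<bar>max_kernel s t - max_kernel s' t'\<bar>
      \<le> c * (r / 4) powr (- c - 1) * \<bar>max (norm s) (norm t) - max (norm s') (norm t')\<bar>"
    unfolding max_kernel_def c_def [symmetric]
    using r s't' norm_triangle_ineq4[of s t] norm_triangle_ineq4[of s' t']
    by (intro powr_minus_lipschitz c) auto
  also have "\<dots> \<le> c * (r / 4) powr (- c - 1) * e"
    using m c by (intro mult_left_mono) auto
  also have "(r / 4) powr (- c - 1) = 4 powr (c + 1) * (r powr (- c) / r)"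
  proof -
    have "(r / 4) powr (- (c + 1)) = r powr (- (c + 1)) / 4 powr (- (c + 1))"
      by (rule powr_divide)
    also have "\<dots> = 4 powr (c + 1) * r powr (- (c + 1))"
      by (simp only: powr_minus[of 4] divide_inverse inverse_inverse_eq mult.commute)
    also have "- (c + 1) = - c - 1" by simp
    also have "r powr (- c - 1) = r powr (- c) / r"
      using r powr_diff[of r "- c" 1] by simp
    finally show ?thesis by simp
  qed
  finally show ?thesis by (simp add: ac_simps)
qed

lemma dini_modulus_linear:
  assumes "0 \<le> C"
  shows "dini_modulus (\<lambda>r. C * r)"
proof -
  have "(\<integral>\<^sup>+r\<in>{0<..1}. ennreal ((C * r)\<^sup>2 / r) \<partial>lebesgue) \<le> (\<integral>\<^sup>+r. ennreal (C\<^sup>2) * indicator {0<..1::real} r \<partial>lebesgue)"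
  proof (rule nn_integral_mono)
    fix r :: real
    show "ennreal ((C * r)\<^sup>2 / r) * indicator {0<..1} r \<le> ennreal (C\<^sup>2) * indicator {0<..1} r"
    proof (cases "r \<in> {0<..1}")
      case True
      then have "(C * r)\<^sup>2 / r = C\<^sup>2 * r" by (simp add: power2_eq_square)
      also have "\<dots> \<le> C\<^sup>2" using True by (simp add: mult_left_le)
      finally show ?thesis by (auto intro!: mult_right_mono ennreal_leI)
    qed simp
  qed
  also have "\<dots> < \<top>" by (simp add: nn_integral_cmult_indicator ennreal_mult_less_top)
  finally show ?thesis
    using assms by (auto simp: dini_modulus_def mono_on_def distrib_left intro!: mult_left_mono)
qed

lemma dini_rank_one_kernel:
  "\<exists>\<omega>. dini_kernel \<omega> (rank_one_kernel \<xi> y :: ('a::euclidean_space, 'x::real_normed_vector, 'y::real_normed_vector) kernel)"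
proof -
  define c where "c = real DIM('a) / 2"
  define A where "A = norm (blinfun_scaleR_left y o\<^sub>L \<xi>)"
  define C where "C = c * 4 powr (c + 1) * A"
  have C: "C \<ge> 0" by (simp add: C_def c_def A_def)
  \<comment> \<open>Only the change of the larger norm matters, and this is at most the displacement
    of either variable. Stating the estimate for two arbitrary pairs serves both Dini
    conditions.\<close>
  have main: "norm (rank_one_kernel \<xi> y s t - rank_one_kernel \<xi> y s' t' :: 'x \<Rightarrow>\<^sub>L 'y)
      \<le> C * (e / norm (s - t)) * norm (s - t) powr (- c)"
    if "s \<noteq> t" "\<bar>max (norm s) (norm t) - max (norm s') (norm t')\<bar> \<le> e" "norm (s - t) / 2 \<le> norm (s' - t')"
    for s t s' t' :: 'a and e
  proof -
    have "norm (rank_one_kernel \<xi> y s t - rank_one_kernel \<xi> y s' t' :: 'x \<Rightarrow>\<^sub>L 'y)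
        = \<bar>max_kernel s t - max_kernel s' t'\<bar> * A"
      by (simp add: rank_one_kernel_def A_def scaleR_left_diff_distrib [symmetric])
    also have "\<dots> \<le> (c * 4 powr (c + 1) * (e / norm (s - t)) * norm (s - t) powr (- c)) * A"
      unfolding c_def using that
      by (intro mult_right_mono max_kernel_lipschitz) (auto simp: A_def)
    finally show ?thesis by (simp add: C_def ac_simps)
  qed
  have "dini_kernel (\<lambda>r. C * r) (rank_one_kernel \<xi> y :: ('a, 'x, 'y) kernel)"
    unfolding dini_kernel_def c_def [symmetric]
  proof (intro conjI allI impI)
    show "dini_modulus (\<lambda>r. C * r)" by (rule dini_modulus_linear[OF C])
    fix s t u :: 'a
    show "norm (rank_one_kernel \<xi> y s t - rank_one_kernel \<xi> y u t :: 'x \<Rightarrow>\<^sub>L 'y)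
        \<le> C * (norm (s - u) / norm (s - t)) * norm (s - t) powr (- c)"
      if "norm (s - u) \<le> norm (s - t) / 2"
    proof (cases "s = t")
      case False
      show ?thesis
      proof (rule main[OF False])
        show "\<bar>max (norm s) (norm t) - max (norm u) (norm t)\<bar> \<le> norm (s - u)"
          using norm_triangle_ineq3[of s u] by linarith
        have "norm (s - t) \<le> norm (s - u) + norm (u - t)"
          using norm_triangle_ineq[of "s - u" "u - t"] by simp
        with that show "norm (s - t) / 2 \<le> norm (u - t)" by linarith
      qed
    qed (use that in simp)
    show "norm (rank_one_kernel \<xi> y s t - rank_one_kernel \<xi> y s u :: 'x \<Rightarrow>\<^sub>L 'y)
        \<le> C * (norm (t - u) / norm (s - t)) * norm (s - t) powr (- c)"
      if "norm (t - u) \<le> norm (s - t) / 2"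
    proof (cases "s = t")
      case False
      show ?thesis
      proof (rule main[OF False])
        show "\<bar>max (norm s) (norm t) - max (norm s) (norm u)\<bar> \<le> norm (t - u)"
          using norm_triangle_ineq3[of t u] by linarith
        have "norm (s - t) \<le> norm (s - u) + norm (t - u)"
          using norm_triangle_ineq4[of "s - u" "t - u"] by simp
        with that show "norm (s - t) / 2 \<le> norm (s - u)" by linarith
      qed
    qed (use that in simp)
  qed
  then show ?thesis by blast
qed

section \<open>Measurability and weak bound of the kernel operator\<close>

lemma powr_minus_half_square: "(x powr (- (c / 2)))\<^sup>2 = inverse (x powr c)" for x c :: real
  unfolding power2_eq_square powr_minus [symmetric] powr_add [symmetric] by simp

lemma max_kernel_nonneg: "0 \<le> max_kernel s t"
  by (simp add: max_kernel_def)

text \<open>The negative power is decreasing, but only off the origin: \<open>0 powr _\<close> is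
  \<open>0\<close>. The form with \<open>min\<close> separates the dependence on \<open>s\<close>
  into a single real parameter.\<close>

lemma max_kernel_eq_min:
  assumes "s \<noteq> 0" "t \<noteq> 0"
  shows "max_kernel s t = min (norm s powr (- (DIM('a) / 2))) (norm (t :: 'a::euclidean_space) powr (- (DIM('a) / 2)))"
proof (cases "norm s \<le> norm t")
  case True
  then have "norm t powr (- (DIM('a) / 2)) \<le> norm s powr (- (DIM('a) / 2))"
    using assms by (intro powr_mono2') auto
  with True show ?thesis by (simp add: max_kernel_def max_def min_def)
next
  case False
  then have "norm s powr (- (DIM('a) / 2)) \<le> norm t powr (- (DIM('a) / 2))"
    using assms by (intro powr_mono2') auto
  with False show ?thesis by (simp add: max_kernel_def max_def min_def)
qed

lemma max_kernel_le:
  assumes "s \<noteq> (0 :: 'a::euclidean_space)"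
  shows "max_kernel s t \<le> norm s powr (- (DIM('a) / 2))"
  unfolding max_kernel_def using assms by (intro powr_mono2') auto

lemma
  fixes f :: "'a::euclidean_space \<Rightarrow> 'x::real_normed_vector" and \<xi> :: "'x \<Rightarrow>\<^sub>L real"
  assumes h: "square_integrable (\<lambda>t. blinfun_apply \<xi> (f t))" and s: "s \<noteq> 0"
  shows square_integrable_max_kernel: "square_integrable (\<lambda>t. max_kernel s t * blinfun_apply \<xi> (f t))"
    and gamma_function_kernel: "gamma_function (\<lambda>t. blinfun_apply (rank_one_kernel \<xi> y s t) (f t))"
    and kernel_op_eq: "kernel_op (rank_one_kernel \<xi> y) f s
      = rank_one (abs_L2 (\<lambda>t. max_kernel s t * blinfun_apply \<xi> (f t))) y"
    and gamma_norm_kernel_op: "gamma_norm (kernel_op (rank_one_kernel \<xi> y) f s)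
      = sqrt (\<integral>t. (max_kernel s t * blinfun_apply \<xi> (f t))\<^sup>2 \<partial>lebesgue) * norm y"
    and gamma_norm_kernel_op_le: "gamma_norm (kernel_op (rank_one_kernel \<xi> y) f s)
      \<le> norm s powr (- (DIM('a) / 2)) * sqrt (\<integral>t. (blinfun_apply \<xi> (f t))\<^sup>2 \<partial>lebesgue) * norm y"
proof -
  have b: "AE t in lebesgue. \<bar>max_kernel s t\<bar> \<le> norm s powr (- (DIM('a) / 2))"
    using max_kernel_le[OF s] by (auto simp: max_kernel_nonneg)
  have m: "max_kernel s \<in> borel_measurable lebesgue"
    by (rule measurable_completion) simp
  show 1: "square_integrable (\<lambda>t. max_kernel s t * blinfun_apply \<xi> (f t))"
    by (rule square_integrable_bounded_mult(1)[OF h m b])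
  show "gamma_function (\<lambda>t. blinfun_apply (rank_one_kernel \<xi> y s t) (f t))"
    unfolding rank_one_kernel_apply by (rule gamma_function_scalar[OF 1])
  show 2: "kernel_op (rank_one_kernel \<xi> y) f s
      = rank_one (abs_L2 (\<lambda>t. max_kernel s t * blinfun_apply \<xi> (f t))) y"
    unfolding kernel_op_def rank_one_kernel_apply by (rule fun_operator_scalar[OF 1])
  show 3: "gamma_norm (kernel_op (rank_one_kernel \<xi> y) f s)
      = sqrt (\<integral>t. (max_kernel s t * blinfun_apply \<xi> (f t))\<^sup>2 \<partial>lebesgue) * norm y"
    unfolding 2 rank_one_gamma(2) norm_abs_L2[OF 1] ..
  have "sqrt (\<integral>t. (max_kernel s t * blinfun_apply \<xi> (f t))\<^sup>2 \<partial>lebesgue)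
     \<le> sqrt ((norm s powr (- (DIM('a) / 2)))\<^sup>2 * (\<integral>t. (blinfun_apply \<xi> (f t))\<^sup>2 \<partial>lebesgue))"
    by (intro real_sqrt_le_mono square_integrable_bounded_mult(2)[OF h m b])
  also have "\<dots> = norm s powr (- (DIM('a) / 2)) * sqrt (\<integral>t. (blinfun_apply \<xi> (f t))\<^sup>2 \<partial>lebesgue)"
    by (simp add: real_sqrt_mult)
  finally show "gamma_norm (kernel_op (rank_one_kernel \<xi> y) f s)
      \<le> norm s powr (- (DIM('a) / 2)) * sqrt (\<integral>t. (blinfun_apply \<xi> (f t))\<^sup>2 \<partial>lebesgue) * norm y"
    unfolding 3 by (intro mult_right_mono) auto
qed

text \<open>The operator at \<open>s\<close> depends only on \<open>b = |s|\<^sup>-\<^sup>d\<^sup>/\<^sup>2\<close>, through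
  \<open>t \<mapsto> min b |t|\<^sup>-\<^sup>d\<^sup>/\<^sup>2\<close>, and is Lipschitz in \<open>b\<close>; so simple functions approximating
  \<open>b\<close> yield simple functions approximating the operator.\<close>

lemma strongly_measurable_kernel_op:
  fixes f :: "'a::euclidean_space \<Rightarrow> 'x::real_normed_vector" and \<xi> :: "'x \<Rightarrow>\<^sub>L real"
  assumes h: "square_integrable (\<lambda>t. blinfun_apply \<xi> (f t))"
  shows "strongly_measurable_in gamma_space gamma_norm (kernel_op (rank_one_kernel \<xi> y) f)"
proof -
  define c where "c = DIM('a) / 2"
  define k where "k b t = min b (norm t powr (- c))" for b :: real and t :: 'a
  define H where "H b = abs_L2 (\<lambda>t. k b t * blinfun_apply \<xi> (f t))" for b
  define B where "B = sqrt (\<integral>t. (blinfun_apply \<xi> (f t))\<^sup>2 \<partial>lebesgue)"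
  have [measurable]: "k b \<in> borel_measurable lebesgue" for b
    unfolding k_def [abs_def] by (rule measurable_completion) measurable
  \<comment> \<open>Simple approximants of \<open>norm s powr (- c)\<close> may be negative, so the
    bound is required for every real \<open>b\<close>.\<close>
  have kb: "\<bar>k b t\<bar> \<le> \<bar>b\<bar>" for b t
    using powr_ge_zero[of "norm t" "- c"] unfolding k_def by linarith
  have kdiff: "\<bar>k b t - k b' t\<bar> \<le> \<bar>b - b'\<bar>" for b b' t
    unfolding k_def by linarith
  have int: "square_integrable (\<lambda>t. k b t * blinfun_apply \<xi> (f t))" for b
    using kb by (intro square_integrable_bounded_mult(1)[OF h]) auto
  have lip: "norm (H b - H b') \<le> \<bar>b - b'\<bar> * B" for b b'
  proof -
    have *: "H b - H b' = abs_L2 (\<lambda>t. (k b t - k b' t) * blinfun_apply \<xi> (f t))"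
      using int unfolding H_def
      by (subst minus_L2.abs_eq) (auto simp: L2_eq_def left_diff_distrib)
    have "AE t in lebesgue. \<bar>k b t - k b' t\<bar> \<le> \<bar>b - b'\<bar>" using kdiff by simp
    note ** = square_integrable_bounded_mult[OF h _ this]
    have [measurable]: "(\<lambda>t. k b t - k b' t) \<in> borel_measurable lebesgue" by measurable
    have "norm (H b - H b') \<le> sqrt (\<bar>b - b'\<bar>\<^sup>2 * (\<integral>t. (blinfun_apply \<xi> (f t))\<^sup>2 \<partial>lebesgue))"
      unfolding * by (subst norm_abs_L2; intro real_sqrt_le_mono **) measurable
    then show ?thesis by (simp add: real_sqrt_mult B_def)
  qed
  have op: "kernel_op (rank_one_kernel \<xi> y) f s = rank_one (H (norm s powr (- c))) y" if s: "s \<noteq> 0" for s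
  proof -
    have "AE t in lebesgue. max_kernel s t * blinfun_apply \<xi> (f t) = k (norm s powr (- c)) t * blinfun_apply \<xi> (f t)"
      using AE_lebesgue_neq[of 0] by eventually_elim (simp add: max_kernel_eq_min[OF s] k_def c_def)
    then have "abs_L2 (\<lambda>t. max_kernel s t * blinfun_apply \<xi> (f t)) = H (norm s powr (- c))"
      unfolding H_def by (intro abs_L2_eqI) (simp add: L2_eq_def int square_integrable_max_kernel[OF h s])
    then show ?thesis by (simp add: kernel_op_eq[OF h s])
  qed
  have "(\<lambda>s :: 'a. norm s powr (- c)) \<in> borel_measurable lebesgue"
    by (rule measurable_completion) measurable
  from borel_measurable_implies_sequence_metric[OF this, of 0]
  obtain F where F: "\<And>i. simple_function lebesgue (F i)" "\<And>s :: 'a. (\<lambda>i. F i s) \<longlonglongrightarrow> norm s powr (- c)"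
    by auto
  have lim: "(\<lambda>i. gamma_norm (rank_one (H (F i s)) y - kernel_op (rank_one_kernel \<xi> y) f s)) \<longlonglongrightarrow> 0"
    if s: "s \<noteq> 0" for s
  proof (rule tendsto_sandwich)
    show "\<forall>\<^sub>F i in sequentially. 0 \<le> gamma_norm (rank_one (H (F i s)) y - kernel_op (rank_one_kernel \<xi> y) f s)"
      by (simp add: op[OF s] rank_one_diff_left [symmetric] rank_one_gamma(2))
    show "\<forall>\<^sub>F i in sequentially. gamma_norm (rank_one (H (F i s)) y - kernel_op (rank_one_kernel \<xi> y) f s)
        \<le> \<bar>F i s - norm s powr (- c)\<bar> * B * norm y"
      by (auto simp: op[OF s] rank_one_diff_left [symmetric] rank_one_gamma(2) intro!: always_eventually mult_right_mono lip)
    have "(\<lambda>i. \<bar>F i s - norm s powr (- c)\<bar> * B * norm y) \<longlonglongrightarrow> \<bar>norm s powr (- c) - norm s powr (- c)\<bar> * B * norm y"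
      by (intro tendsto_intros F(2))
    then show "(\<lambda>i. \<bar>F i s - norm s powr (- c)\<bar> * B * norm y) \<longlonglongrightarrow> 0" by simp
  qed simp
  show ?thesis
    unfolding strongly_measurable_in_def
  proof (intro conjI exI[of _ "\<lambda>i s. rank_one (H (F i s)) y"] allI)
    show "AE s in lebesgue. kernel_op (rank_one_kernel \<xi> y) f s \<in> gamma_space"
      using AE_lebesgue_neq[of 0] by eventually_elim (simp add: op rank_one_gamma(1))
    show "simple_function lebesgue (\<lambda>s. rank_one (H (F i s)) y)" for i
      by (rule simple_function_compose1[OF F(1)])
    show "range (\<lambda>s. rank_one (H (F i s)) y) \<subseteq> gamma_space" for i
      by (auto simp: rank_one_gamma(1))
    show "AE s in lebesgue. (\<lambda>i. gamma_norm (rank_one (H (F i s)) y - kernel_op (rank_one_kernel \<xi> y) f s)) \<longlonglongrightarrow> 0"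
      using AE_lebesgue_neq[of 0] by eventually_elim (rule lim)
  qed
qed

lemma ennpowr_mono: "x \<le> y \<Longrightarrow> 0 \<le> a \<Longrightarrow> ennpowr x a \<le> ennpowr y a"
  by (cases x; cases y) (auto simp: ennpowr_def top_unique intro!: ennreal_leI powr_mono2)

lemma rank_one_kernel_weak_bound:
  fixes \<xi> :: "'x::real_normed_vector \<Rightarrow>\<^sub>L real"
  assumes \<xi>: "\<And>x. \<bar>blinfun_apply \<xi> x\<bar> \<le> norm x"
  shows "kernel_bound 2 (\<lambda>_. 1) (weak_Lp_norm 2 (\<lambda>_. 1) gamma_norm)
    (rank_one_kernel \<xi> y :: ('a::euclidean_space, 'x, 'y::real_normed_vector) kernel)
    (sqrt (ball_const TYPE('a)) * norm y)"
  unfolding kernel_bound_def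
proof (intro conjI ballI)
  show "0 \<le> sqrt (ball_const TYPE('a)) * norm y" by simp
  let ?K = "rank_one_kernel \<xi> y :: ('a, 'x, 'y) kernel"
  fix f :: "'a \<Rightarrow> 'x" assume f: "f \<in> Lp_space 2 (\<lambda>_. 1)"
  define N where "N = (\<integral>\<^sup>+s. ennreal ((norm (f s))\<^sup>2) \<partial>lebesgue)"
  have Lp: "Lp_norm 2 (\<lambda>_. 1) norm f = ennpowr N (1 / 2)"
    by (simp add: Lp_norm_def N_def powr_numeral)
  with f have "N \<noteq> \<top>" by (auto simp: Lp_space_def ennpowr_def)
  then obtain n where n: "N = ennreal n" "n \<ge> 0" by (cases N) auto
  have Lp': "Lp_norm 2 (\<lambda>_. 1) norm f = ennreal (sqrt n)"
    using n by (simp add: Lp ennpowr_def powr_half_sqrt)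
  have m: "(\<lambda>t. blinfun_apply \<xi> (f t)) \<in> borel_measurable lebesgue"
    using f by (intro borel_measurable_functional) (simp add: Lp_space_def)
  have le: "(\<integral>\<^sup>+t. ennreal ((blinfun_apply \<xi> (f t))\<^sup>2) \<partial>lebesgue) \<le> ennreal n"
    unfolding n(1) [symmetric] N_def
    using \<xi> by (intro nn_integral_mono ennreal_leI) (simp add: abs_le_square_iff [symmetric])
  have int: "integrable lebesgue (\<lambda>t. (blinfun_apply \<xi> (f t))\<^sup>2)"
    using m le by (intro integrableI_bounded) (auto intro: le_less_trans)
  then have h: "square_integrable (\<lambda>t. blinfun_apply \<xi> (f t))"
    using m by (simp add: square_integrable_def)
  have hn: "(\<integral>t. (blinfun_apply \<xi> (f t))\<^sup>2 \<partial>lebesgue) \<le> n"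
    using le n(2) nn_integral_eq_integral[OF int] by simp
  show "AE s in lebesgue. gamma_function (\<lambda>t. blinfun_apply (?K s t) (f t))"
    using AE_lebesgue_neq[of 0] by eventually_elim (rule gamma_function_kernel[OF h])
  show "strongly_measurable_in gamma_space gamma_norm (kernel_op ?K f)"
    by (rule strongly_measurable_kernel_op[OF h])
  show "weak_Lp_norm 2 (\<lambda>_. 1) gamma_norm (kernel_op ?K f)
      \<le> ennreal (sqrt (ball_const TYPE('a)) * norm y) * Lp_norm 2 (\<lambda>_. 1) norm f"
    unfolding weak_Lp_norm_def
  proof (rule SUP_least)
    fix l :: real assume "l \<in> {0<..}"
    then have l: "l > 0" by simp
    \<comment> \<open>Solving \<open>l < norm s powr (- (DIM('a) / 2)) * sqrt n * norm y\<close> for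
      \<open>radial_vol s\<close> gives this radius; \<open>l * sqrt r\<close> no longer depends on
      \<open>l\<close>.\<close>
    define r where "r = (norm y)\<^sup>2 * n / l\<^sup>2"
    have r: "r \<ge> 0" using n(2) by (simp add: r_def)
    have level: "radial_vol s \<le> r" if "gamma_norm (kernel_op ?K f s) > l" "s \<noteq> 0" for s
    proof -
      have "l < norm s powr (- (DIM('a) / 2)) * sqrt (\<integral>t. (blinfun_apply \<xi> (f t))\<^sup>2 \<partial>lebesgue) * norm y"
        using that gamma_norm_kernel_op_le[OF h, of s y] by simp
      also have "\<dots> \<le> norm s powr (- (DIM('a) / 2)) * sqrt n * norm y"
        using hn by (intro mult_right_mono mult_left_mono) auto
      finally have "l\<^sup>2 \<le> (norm s powr (- (DIM('a) / 2)) * sqrt n * norm y)\<^sup>2"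
        using l by (intro power_mono) auto
      also have "\<dots> = (norm s powr (- (DIM('a) / 2)))\<^sup>2 * n * (norm y)\<^sup>2"
        using n(2) by (simp add: power_mult_distrib)
      also have "(norm s powr (- (DIM('a) / 2)))\<^sup>2 = inverse (radial_vol s)"
        by (rule powr_minus_half_square)
      finally show ?thesis using that l by (simp add: r_def field_simps)
    qed
    have "(\<integral>\<^sup>+s\<in>{s. gamma_norm (kernel_op ?K f s) > l}. ennreal 1 \<partial>lebesgue)
      \<le> (\<integral>\<^sup>+s. indicator {s :: 'a. radial_vol s \<le> r} s \<partial>lebesgue)"
      using level r
      by (intro nn_integral_mono_AE eventually_mono[OF AE_lebesgue_neq[of 0]])
        (auto split: split_indicator)
    also have "\<dots> = emeasure lebesgue {s :: 'a. radial_vol s \<le> r}"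
      by (rule nn_integral_indicator) (simp add: sets_completionI_sets)
    also have "\<dots> = ennreal (ball_const TYPE('a) * r)"
      using radial_vol_level_emeasure[OF r, where 'a = 'a] by simp
    finally have "ennpowr (\<integral>\<^sup>+s\<in>{s. gamma_norm (kernel_op ?K f s) > l}. ennreal 1 \<partial>lebesgue) (1 / 2)
      \<le> ennreal (sqrt (ball_const TYPE('a) * r))"
      using r ennpowr_le[of _ "ball_const TYPE('a) * r" "1 / 2"] by (simp add: powr_half_sqrt)
    then have "ennreal l * ennpowr (\<integral>\<^sup>+s\<in>{s. gamma_norm (kernel_op ?K f s) > l}. ennreal 1 \<partial>lebesgue) (1 / 2)
      \<le> ennreal l * ennreal (sqrt (ball_const TYPE('a) * r))"
      by (rule mult_left_mono) simp
    also have "\<dots> = ennreal (sqrt (ball_const TYPE('a)) * norm y) * ennreal (sqrt n)"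
      using l n(2) by (simp add: ennreal_mult [symmetric] r_def real_sqrt_mult real_sqrt_divide)
    finally show "ennreal l * ennpowr (\<integral>\<^sup>+s\<in>{s. gamma_norm (kernel_op ?K f s) > l}. ennreal 1 \<partial>lebesgue) (1 / 2)
      \<le> ennreal (sqrt (ball_const TYPE('a)) * norm y) * Lp_norm 2 (\<lambda>_. 1) norm f"
      by (simp add: Lp')
  qed
qed
subsection \<open>Testing on truncated powers\<close>

abbreviation truncated_power :: "real \<Rightarrow> 'a::euclidean_space \<Rightarrow> real" where
  "truncated_power b t \<equiv> radial_vol t powr b * indicator {..1} (radial_vol t)"

lemma truncated_power_square: "(truncated_power b t)\<^sup>2 = truncated_power (2 * b) t"
  by (simp add: power2_eq_square powr_add [symmetric] split: split_indicator)

lemma square_integrable_truncated_power: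
  assumes "-1 < 2 * b"
  shows "square_integrable (truncated_power b :: 'a::euclidean_space \<Rightarrow> real)"
  unfolding square_integrable_def truncated_power_square
proof
  show m: "(truncated_power b :: 'a \<Rightarrow> real) \<in> borel_measurable lebesgue" for b
    by (rule measurable_completion) measurable
  have "(\<integral>\<^sup>+t. ennreal (norm (truncated_power (2 * b) t)) \<partial>(lebesgue :: 'a measure))
    = (\<integral>\<^sup>+t. ennreal (radial_vol t powr (2 * b)) * indicator {..1} (radial_vol t) \<partial>(lebesgue :: 'a measure))"
    by (intro nn_integral_cong) (simp split: split_indicator)
  also have "\<dots> < \<infinity>"
    using assms by (subst nn_integral_radial_powr) auto
  finally show "integrable lebesgue (truncated_power (2 * b) :: 'a \<Rightarrow> real)"
    by (intro integrableI_bounded m)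
qed

lemma nn_integral_max_kernel_truncated_power:
  fixes s :: "'a::euclidean_space"
  assumes "s \<noteq> 0"
  shows "(\<integral>\<^sup>+t. ennreal ((max_kernel s t * truncated_power b t)\<^sup>2) \<partial>lebesgue)
    = ball_const TYPE('a) * (\<integral>\<^sup>+r\<in>{0..}. ennreal (inverse (max (radial_vol s) r) * (r powr (2 * b) * indicator {..1} r)) \<partial>lborel)"
proof -
  have "(max_kernel s t)\<^sup>2 = inverse (max (radial_vol s) (radial_vol t))" for t :: 'a
  proof -
    have "max (norm s) (norm t) powr DIM('a) = max (radial_vol s) (radial_vol t)"
      by (cases "norm s \<le> norm t") (simp_all add: max_def powr_mono2 not_le powr_less_mono2 order_antisym)
    then show ?thesis by (simp add: max_kernel_def powr_minus_half_square)
  qed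
  then have "(max_kernel s t * truncated_power b t)\<^sup>2
    = inverse (max (radial_vol s) (radial_vol t)) * truncated_power (2 * b) t" for t :: 'a
    by (simp only: power_mult_distrib[of "max_kernel s t"] truncated_power_square)
  then show ?thesis
    by (simp only:) (rule nn_integral_radial, measurable)
qed

text \<open>Only the shell between radial volumes \<open>u\<close> and 1 is kept. There the squared
  kernel is \<open>1 / r\<close>, whose integral is the logarithm.\<close>

lemma max_kernel_logarithmic_lower_bound:
  fixes s :: "'a::euclidean_space"
  assumes s: "s \<noteq> 0" "radial_vol s \<le> 1"
  shows "ennreal (ball_const TYPE('a) * - ln (radial_vol s))
    \<le> (\<integral>\<^sup>+t. ennreal ((max_kernel s t * truncated_power 0 t)\<^sup>2) \<partial>lebesgue)"
proof -
  define u where "u = radial_vol s"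
  have u: "0 < u" "u \<le> 1" using s by (auto simp: u_def)
  have "ennreal (- ln u) = (\<integral>\<^sup>+r. ennreal (inverse r) * indicator {u..1} r \<partial>lborel)"
    using u by (subst nn_integral_FTC_Icc[where F = ln]) (auto intro!: derivative_eq_intros simp: divide_inverse)
  also have "\<dots> \<le> (\<integral>\<^sup>+r\<in>{0..}. ennreal (inverse (max u r) * (r powr (2 * 0) * indicator {..1} r)) \<partial>lborel)"
    using u by (intro nn_integral_mono) (auto split: split_indicator simp: max_def)
  finally have "ennreal (ball_const TYPE('a)) * ennreal (- ln u) \<le> ennreal (ball_const TYPE('a))
      * (\<integral>\<^sup>+r\<in>{0..}. ennreal (inverse (max u r) * (r powr (2 * 0) * indicator {..1} r)) \<partial>lborel)"
    by (rule mult_left_mono) simp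
  moreover have "ennreal (ball_const TYPE('a) * - ln u) = ennreal (ball_const TYPE('a)) * ennreal (- ln u)"
    using u by (intro ennreal_mult) auto
  ultimately show ?thesis
    unfolding nn_integral_max_kernel_truncated_power[OF s(1)] u_def by (simp only:)
qed

text \<open>Only the ball of radial volume \<open>u\<close> is kept. There the squared kernel is the
  constant \<open>1 / u\<close>, and integrating the power brings in the large factor
  \<open>1 / (2 * b + 1)\<close>.\<close>

lemma max_kernel_power_lower_bound:
  fixes s :: "'a::euclidean_space"
  assumes s: "s \<noteq> 0" "radial_vol s \<le> 1" and b: "-1 < 2 * b"
  shows "ennreal (ball_const TYPE('a) / (2 * b + 1) * radial_vol s powr (2 * b))
    \<le> (\<integral>\<^sup>+t. ennreal ((max_kernel s t * truncated_power b t)\<^sup>2) \<partial>lebesgue)"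
proof -
  define u where "u = radial_vol s"
  have u: "0 < u" "u \<le> 1" using s by (auto simp: u_def)
  have "u powr (2 * b) / (2 * b + 1) = inverse u * (u powr (2 * b + 1) / (2 * b + 1))"
    using u by (simp add: powr_add)
  also have "ennreal \<dots> = ennreal (inverse u) * ennreal (u powr (2 * b + 1) / (2 * b + 1))"
    using u b by (intro ennreal_mult) auto
  also have "ennreal (u powr (2 * b + 1) / (2 * b + 1)) = (\<integral>\<^sup>+r. ennreal (r powr (2 * b)) * indicator {0..u} r \<partial>lborel)"
    using u b by (intro nn_integral_has_integral_lebesgue' [symmetric] has_integral_powr_from_0) auto
  also have "ennreal (inverse u) * \<dots> = (\<integral>\<^sup>+r. ennreal (inverse u) * (ennreal (r powr (2 * b)) * indicator {0..u} r) \<partial>lborel)"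
    by (rule nn_integral_cmult [symmetric]) measurable
  also have "\<dots> \<le> (\<integral>\<^sup>+r\<in>{0..}. ennreal (inverse (max u r) * (r powr (2 * b) * indicator {..1} r)) \<partial>lborel)"
    using u by (intro nn_integral_mono) (auto split: split_indicator simp: max_def ennreal_mult [symmetric])
  finally have "ennreal (ball_const TYPE('a)) * ennreal (u powr (2 * b) / (2 * b + 1)) \<le> ennreal (ball_const TYPE('a))
      * (\<integral>\<^sup>+r\<in>{0..}. ennreal (inverse (max u r) * (r powr (2 * b) * indicator {..1} r)) \<partial>lborel)"
    by (rule mult_left_mono) simp
  then show ?thesis
    using u b unfolding nn_integral_max_kernel_truncated_power[OF s(1)] u_def by (simp add: ennreal_mult [symmetric])
qed

text \<open>The test function is \<open>truncated_power b\<close> times \<open>x0\<close>. By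
  \<open>rel\<close> its \<open>p\<close>-th power times the weight is proportional to
  \<open>radial_vol s powr (\<delta> - 1)\<close> on the unit ball. By \<open>lower\<close> the same
  density, times \<open>L powr (p / 2)\<close>, bounds the image from below on radial volume at most
  \<open>\<rho>\<close>. The masses of the two balls have ratio \<open>\<rho> powr \<delta>\<close>,
  and a \<open>p\<close>-th root finishes.\<close>

lemma K_gamma_norm_lower_bound:
  fixes \<xi> :: "'x::real_normed_vector \<Rightarrow>\<^sub>L real" and y :: "'y::real_normed_vector"
  defines "K \<equiv> rank_one_kernel \<xi> y :: ('a::euclidean_space, 'x, 'y) kernel"
  assumes p: "0 < p" and \<delta>: "0 < \<delta>" and rel: "b * p + a = \<delta> - 1" and b: "-1 < 2 * b"
    and \<rho>: "0 < \<rho>" "\<rho> \<le> 1"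
    and x0: "blinfun_apply \<xi> x0 = norm x0" "x0 \<noteq> 0"
    and lower: "\<And>s :: 'a. s \<noteq> 0 \<Longrightarrow> radial_vol s \<le> \<rho> \<Longrightarrow>
      ennreal (L * radial_vol s powr (2 * b)) \<le> (\<integral>\<^sup>+t. ennreal ((max_kernel s t * truncated_power b t)\<^sup>2) \<partial>lebesgue)"
    and L: "0 \<le> L"
    and K: "K \<in> K_gamma p (power_weight a)"
  shows "norm y * (L powr (p / 2) * \<rho> powr \<delta>) powr (1 / p) \<le> K_gamma_norm p (power_weight a) K"
  unfolding K_gamma_norm_def
proof (rule cInf_greatest)
  \<comment> \<open>Membership in \<open>K_gamma\<close> makes this infimum of reals one over a
    nonempty set.\<close>
  show "{C. kernel_bound p (power_weight a) (Lp_norm p (power_weight a) gamma_norm) K C} \<noteq> {}"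
    using K by (auto simp: K_gamma_def)
  define g where "g = (truncated_power b :: 'a \<Rightarrow> real)"
  define f where "f t = g t *\<^sub>R x0" for t
  \<comment> \<open>\<open>I\<close> is the mass of the unit ball for the density
    \<open>radial_vol s powr (\<delta> - 1)\<close>. It occurs on both sides and cancels, as does
    \<open>norm x0\<close>.\<close>
  define I where "I = ball_const TYPE('a) / \<delta>"
  define G where "G = L powr (p / 2) * \<rho> powr \<delta>"
  have I: "I > 0" using \<delta> by (simp add: I_def)
  have nx: "norm x0 > 0" using x0(2) by simp
  have sg: "square_integrable g" unfolding g_def by (rule square_integrable_truncated_power[OF b])
  have g0: "g t \<ge> 0" for t by (simp add: g_def)
  have \<xi>f: "blinfun_apply \<xi> (f t) = norm x0 * g t" for t
    by (simp add: f_def blinfun.scaleR_right x0(1))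
  have sf: "square_integrable (\<lambda>t. blinfun_apply \<xi> (f t))"
    unfolding \<xi>f by (rule square_integrable_scale[OF sg])
  have power_integral: "(\<integral>\<^sup>+s. ennreal (c * (radial_vol s powr (\<delta> - 1) * indicator {..R} (radial_vol s))) \<partial>(lebesgue :: 'a measure))
      = ennreal (c * (R powr \<delta> * I))" if "0 \<le> c" "0 \<le> R" for c R
  proof -
    have "(\<integral>\<^sup>+s. ennreal (c * (radial_vol s powr (\<delta> - 1) * indicator {..R} (radial_vol s))) \<partial>(lebesgue :: 'a measure))
      = (\<integral>\<^sup>+s. ennreal c * (ennreal (radial_vol s powr (\<delta> - 1)) * indicator {..R} (radial_vol s)) \<partial>(lebesgue :: 'a measure))"
      using that by (intro nn_integral_cong) (auto simp: ennreal_mult [symmetric] split: split_indicator)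
    also have "\<dots> = ennreal c * (\<integral>\<^sup>+s. ennreal (radial_vol s powr (\<delta> - 1)) * indicator {..R} (radial_vol s) \<partial>(lebesgue :: 'a measure))"
      by (rule nn_integral_cmult, rule measurable_completion) measurable
    also have "\<dots> = ennreal c * ennreal (R powr \<delta> * I)"
      using that \<delta> by (subst nn_integral_radial_powr) (auto simp: I_def mult.commute)
    finally show ?thesis using that I by (subst ennreal_mult) auto
  qed
  have combine: "(radial_vol s powr b) powr p * power_weight a s = radial_vol s powr (\<delta> - 1)"
    if "s \<noteq> 0" for s :: 'a
  proof -
    have "(radial_vol s powr b) powr p * power_weight a s = radial_vol s powr (b * p + a)"
      using that by (simp add: power_weight_def powr_powr [of "radial_vol s"] powr_add del: powr_powr)
    then show ?thesis by (simp only: rel)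
  qed
  have "(\<integral>\<^sup>+s. ennreal (norm (f s) powr p * power_weight a s) \<partial>lebesgue)
    = (\<integral>\<^sup>+s. ennreal (norm x0 powr p * (radial_vol s powr (\<delta> - 1) * indicator {..1} (radial_vol s))) \<partial>(lebesgue :: 'a measure))"
  proof (rule nn_integral_cong_AE, use AE_lebesgue_neq[of 0] in eventually_elim)
    fix s :: 'a assume "s \<noteq> 0"
    from combine[OF this, symmetric] show "ennreal (norm (f s) powr p * power_weight a s)
      = ennreal (norm x0 powr p * (radial_vol s powr (\<delta> - 1) * indicator {..1} (radial_vol s)))"
      using p by (simp add: f_def g_def powr_mult ac_simps split: split_indicator)
  qed
  also have "\<dots> = ennreal (norm x0 powr p * I)" by (subst power_integral) auto
  finally have Lp: "Lp_norm p (power_weight a) norm f = ennreal (norm x0 * I powr (1 / p))"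
    using p I nx by (simp add: Lp_norm_def ennpowr_def powr_mult powr_powr)
  have "strongly_measurable f"
    unfolding f_def using sg by (intro strongly_measurable_scaleR) (simp add: square_integrable_def)
  with Lp have f: "f \<in> Lp_space p (power_weight a)" by (simp add: Lp_space_def)
  have pointwise: "(norm x0 * norm y) powr p * L powr (p / 2) * (radial_vol s powr (\<delta> - 1) * indicator {..\<rho>} (radial_vol s))
      \<le> gamma_norm (kernel_op K f s) powr p * power_weight a s" if s: "s \<noteq> 0" for s
  proof (cases "radial_vol s \<le> \<rho>")
    case True
    have "(\<lambda>t. (max_kernel s t * blinfun_apply \<xi> (f t))\<^sup>2) = (\<lambda>t. (norm x0)\<^sup>2 * (max_kernel s t * g t)\<^sup>2)"
      by (simp add: \<xi>f power_mult_distrib fun_eq_iff)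
    moreover have "integrable lebesgue (\<lambda>t. (max_kernel s t * blinfun_apply \<xi> (f t))\<^sup>2)"
      using square_integrable_max_kernel[OF sf s] by (simp add: square_integrable_def)
    ultimately have int: "integrable lebesgue (\<lambda>t. (max_kernel s t * g t)\<^sup>2)"
      and eq: "(\<integral>t. (max_kernel s t * blinfun_apply \<xi> (f t))\<^sup>2 \<partial>lebesgue) = (norm x0)\<^sup>2 * (\<integral>t. (max_kernel s t * g t)\<^sup>2 \<partial>lebesgue)"
      using nx by simp_all
    have "ennreal (L * radial_vol s powr (2 * b)) \<le> (\<integral>\<^sup>+t. ennreal ((max_kernel s t * g t)\<^sup>2) \<partial>lebesgue)"
      using lower[OF s True] by (simp only: g_def)
    also have "\<dots> = ennreal (\<integral>t. (max_kernel s t * g t)\<^sup>2 \<partial>lebesgue)"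
      by (rule nn_integral_eq_integral[OF int]) simp
    finally have "L * radial_vol s powr (2 * b) \<le> (\<integral>t. (max_kernel s t * g t)\<^sup>2 \<partial>lebesgue)"
      by (subst (asm) ennreal_le_iff) simp_all
    then have "sqrt (L * radial_vol s powr (2 * b)) \<le> sqrt (\<integral>t. (max_kernel s t * g t)\<^sup>2 \<partial>lebesgue)"
      by (rule real_sqrt_le_mono)
    then have "norm x0 * sqrt (L * radial_vol s powr (2 * b)) * norm y \<le> gamma_norm (kernel_op K f s)"
      unfolding K_def gamma_norm_kernel_op[OF sf s] eq
      by (auto simp: real_sqrt_mult intro!: mult_right_mono mult_left_mono)
    also have "norm x0 * sqrt (L * radial_vol s powr (2 * b)) * norm y
        = (norm x0 * norm y) * (L powr (1 / 2) * radial_vol s powr b)"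
      using L by (simp add: real_sqrt_mult powr_half_sqrt [symmetric] powr_powr ac_simps)
    finally have "((norm x0 * norm y) * (L powr (1 / 2) * radial_vol s powr b)) powr p \<le> gamma_norm (kernel_op K f s) powr p"
      using p by (intro powr_mono2) auto
    then have "((norm x0 * norm y) * (L powr (1 / 2) * radial_vol s powr b)) powr p * power_weight a s
        \<le> gamma_norm (kernel_op K f s) powr p * power_weight a s"
      by (intro mult_right_mono) (auto simp: less_imp_le power_weight_pos)
    also have "((norm x0 * norm y) * (L powr (1 / 2) * radial_vol s powr b)) powr p * power_weight a s
        = (norm x0 * norm y) powr p * L powr (p / 2) * ((radial_vol s powr b) powr p * power_weight a s)"
    proof -
      have "((norm x0 * norm y) * (L powr (1 / 2) * radial_vol s powr b)) powr p
          = (norm x0 * norm y) powr p * ((L powr (1 / 2)) powr p * (radial_vol s powr b) powr p)"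
        by (simp only: powr_mult)
      also have "(L powr (1 / 2)) powr p = L powr (p / 2)" by (simp add: powr_powr)
      finally show ?thesis by (simp only: mult.assoc)
    qed
    finally show ?thesis using True by (simp add: combine[OF s])
  next
    case False
    then show ?thesis by (simp add: less_imp_le power_weight_pos)
  qed
  fix C assume "C \<in> {C. kernel_bound p (power_weight a) (Lp_norm p (power_weight a) gamma_norm) K C}"
  then have C: "0 \<le> C" "Lp_norm p (power_weight a) gamma_norm (kernel_op K f) \<le> ennreal C * Lp_norm p (power_weight a) norm f"
    using f by (auto simp: kernel_bound_def)
  have "ennreal ((norm x0 * norm y) powr p * L powr (p / 2) * (\<rho> powr \<delta> * I))
    = (\<integral>\<^sup>+s. ennreal ((norm x0 * norm y) powr p * L powr (p / 2) * (radial_vol s powr (\<delta> - 1) * indicator {..\<rho>} (radial_vol s))) \<partial>(lebesgue :: 'a measure))"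
    using \<rho> by (subst power_integral) auto
  also have "\<dots> \<le> (\<integral>\<^sup>+s. ennreal (gamma_norm (kernel_op K f s) powr p * power_weight a s) \<partial>lebesgue)"
    by (intro nn_integral_mono_AE eventually_mono[OF AE_lebesgue_neq[of 0]] ennreal_leI pointwise)
  finally have "ennpowr (ennreal ((norm x0 * norm y) powr p * L powr (p / 2) * (\<rho> powr \<delta> * I))) (1 / p)
      \<le> ennreal C * Lp_norm p (power_weight a) norm f"
    using p by (intro order_trans[OF _ C(2)]) (auto simp: Lp_norm_def intro!: ennpowr_mono)
  then have "((norm x0 * norm y) powr p * L powr (p / 2) * (\<rho> powr \<delta> * I)) powr (1 / p) \<le> C * (norm x0 * I powr (1 / p))"
    using C(1) I nx by (simp add: Lp ennpowr_def ennreal_mult [symmetric])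
  also have "((norm x0 * norm y) powr p * L powr (p / 2) * (\<rho> powr \<delta> * I)) powr (1 / p)
      = ((norm x0 * norm y) powr p) powr (1 / p) * (G powr (1 / p) * I powr (1 / p))"
    by (simp only: G_def powr_mult mult.assoc)
  also have "\<dots> = (norm y * G powr (1 / p)) * (norm x0 * I powr (1 / p))"
    using p by (simp add: powr_powr)
  finally show "norm y * (L powr (p / 2) * \<rho> powr \<delta>) powr (1 / p) \<le> C"
    using I nx unfolding G_def by simp
qed

section \<open>Comparison of exponents and conclusion\<close>

lemma powr_exponent_le:
  fixes a b :: real
  assumes "\<And>\<delta>. 0 < \<delta> \<Longrightarrow> \<delta> < 1 \<Longrightarrow> \<delta> powr (- a) \<le> M * \<delta> powr (- b)"
  shows "a \<le> b"
proof (rule ccontr)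
  assume "\<not> a \<le> b"
  then have e: "a - b > 0" by simp
  \<comment> \<open>This choice makes \<open>\<delta> powr (- (a - b))\<close> equal to
    \<open>\<bar>M\<bar> + 2\<close>. The base exceeds \<open>M\<close>, which gives the
    contradiction, and exceeds 1, which keeps \<open>\<delta>\<close> below 1.\<close>
  define \<delta> where "\<delta> = (\<bar>M\<bar> + 2) powr (- (1 / (a - b)))"
  have \<delta>: "0 < \<delta>" "\<delta> < 1"
    using e by (auto simp: \<delta>_def powr_less_one)
  have "\<delta> powr (- (a - b)) = \<bar>M\<bar> + 2"
  proof -
    have "- (1 / (a - b)) * - (a - b) = 1" using e by (simp add: divide_simps)
    then show ?thesis unfolding \<delta>_def powr_powr by (simp only:) simp
  qed
  moreover have "\<delta> powr (- (a - b)) = \<delta> powr (- a) / \<delta> powr (- b)"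
    using powr_diff[of \<delta> "- a" "- b"] by (simp add: algebra_simps)
  moreover have "\<delta> powr (- a) / \<delta> powr (- b) \<le> M"
    using assms[OF \<delta>] \<delta> by (simp add: divide_simps)
  ultimately show False by simp
qed

theorem proposition6p6:
  fixes p \<beta> :: real
  assumes "has_type_2 TYPE('x::banach)" and "has_type_2 TYPE('y::banach)"
    and "\<exists>x::'x. x \<noteq> 0" and "\<exists>y::'y. y \<noteq> 0"
    and "2 < p" and "0 \<le> \<beta>"
  shows "\<exists>K :: (real ^ 'n, 'x, 'y) kernel.
    strongly_measurable_kernel K \<and>
    (\<exists>\<omega>. dini_kernel \<omega> K) \<and>
    (\<exists>r\<ge>2. K \<in> K_gamma_weak r (\<lambda>_. 1)) \<and>
    ((\<exists>C::real. \<forall>w \<in> Ap_class (p / 2).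
        K \<in> K_gamma p w \<and> K_gamma_norm p w K \<le> C * enn2real (Ap_const (p / 2) w) powr \<beta>)
      \<longrightarrow> max (1 / 2) (1 / (p - 2)) \<le> \<beta>)"
proof -
  obtain x0 :: 'x and y :: 'y where x0: "x0 \<noteq> 0" and y: "y \<noteq> 0" using assms(3,4) by blast
  obtain \<xi> :: "'x \<Rightarrow>\<^sub>L real" where \<xi>: "\<And>x. \<bar>blinfun_apply \<xi> x\<bar> \<le> norm x" "blinfun_apply \<xi> x0 = norm x0"
    by (rule norming_functional[of x0]) blast
  define K where "K = (rank_one_kernel \<xi> y :: (real ^ 'n, 'x, 'y) kernel)"
  define V where "V = ball_const TYPE(real ^ 'n)"
  define D where "D = cube_const TYPE(real ^ 'n)"
  define q where "q = p / 2"
  have V: "0 < V" by (simp add: V_def)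
  have D: "0 < D" by (simp add: D_def cube_const_pos)
  have q: "1 < q" using assms(5) by (simp add: q_def)
  have weak: "K \<in> K_gamma_weak 2 (\<lambda>_. 1)"
    using rank_one_kernel_weak_bound[OF \<xi>(1)] by (auto simp: K_gamma_weak_def K_def)
  have "max (1 / 2) (1 / (p - 2)) \<le> \<beta>"
    if C: "\<forall>w \<in> Ap_class q. K \<in> K_gamma p w \<and> K_gamma_norm p w K \<le> C * enn2real (Ap_const q w) powr \<beta>" for C
  proof -
    \<comment> \<open>The given \<open>C\<close> may be negative; with its absolute value the
      right-hand side is monotone in the weight constant, so an upper bound \<open>A\<close> can
      replace that constant.\<close>
    have upper: "K_gamma_norm p w K \<le> \<bar>C\<bar> * A powr \<beta>"
      if "w \<in> Ap_class q" "Ap_const q w \<le> ennreal A" "0 \<le> A" for w A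
    proof -
      have "enn2real (Ap_const q w) \<le> A" using enn2real_mono[OF that(2)] that(3) by simp
      then have "C * enn2real (Ap_const q w) powr \<beta> \<le> \<bar>C\<bar> * A powr \<beta>"
        using assms(6) by (intro mult_mono powr_mono2) auto
      with C that(1) show ?thesis by (meson order_trans)
    qed
    have root: "((V / \<delta>) powr (p / 2) * R) powr (1 / p) = V powr (1 / 2) * R powr (1 / p) * \<delta> powr (- (1 / 2))"
      if "0 < \<delta>" "0 \<le> R" for \<delta> R
      using that V assms(5) by (simp add: powr_mult powr_divide powr_powr powr_minus divide_simps)
    have "1 / 2 \<le> \<beta>"
    proof (rule powr_exponent_le)
      fix \<delta> :: real assume \<delta>: "0 < \<delta>" "\<delta> < 1"
      \<comment> \<open>On radial volume at most \<open>\<rho>\<close> the logarithm is at least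
        \<open>1 / \<delta>\<close>, while \<open>\<rho> powr \<delta>\<close> does not depend on
        \<open>\<delta>\<close>: the tiny ball still carries a fixed fraction of the weighted
        mass.\<close>
      define \<rho> where "\<rho> = exp (- 1 / \<delta>)"
      have "\<rho> powr \<delta> = exp (- 1)" using \<delta> by (simp add: \<rho>_def exp_powr_real)
      have w: "power_weight (\<delta> - 1) \<in> (Ap_class q :: (real ^ 'n \<Rightarrow> real) set)"
        using q \<delta> by (intro power_weight_Ap_class) auto
      have "norm y * ((V / \<delta>) powr (p / 2) * \<rho> powr \<delta>) powr (1 / p) \<le> K_gamma_norm p (power_weight (\<delta> - 1)) K"
        unfolding K_def
      proof (rule K_gamma_norm_lower_bound[where b = 0])
        fix s :: "real ^ 'n" assume s: "s \<noteq> 0" "radial_vol s \<le> \<rho>"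
        then have "ln (radial_vol s) \<le> ln \<rho>" by (intro ln_mono) (auto simp: \<rho>_def)
        then have "1 / \<delta> \<le> - ln (radial_vol s)" by (simp add: \<rho>_def)
        then have "V * (1 / \<delta>) \<le> V * - ln (radial_vol s)"
          using V by (intro mult_left_mono) auto
        then have "ennreal (V / \<delta> * radial_vol s powr (2 * 0)) \<le> ennreal (V * - ln (radial_vol s))"
          using s by (intro ennreal_leI) simp
        also have "\<dots> \<le> (\<integral>\<^sup>+t. ennreal ((max_kernel s t * truncated_power 0 t)\<^sup>2) \<partial>lebesgue)"
        proof -
          have "\<rho> \<le> 1" using \<delta> by (simp add: \<rho>_def)
          with s show ?thesis unfolding V_def by (intro max_kernel_logarithmic_lower_bound) auto
        qed
        finally show "ennreal (V / \<delta> * radial_vol s powr (2 * 0)) \<le> (\<integral>\<^sup>+t. ennreal ((max_kernel s t * truncated_power 0 t)\<^sup>2) \<partial>lebesgue)" .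
      qed (use assms(5) \<delta> x0 \<xi>(2) V C w in \<open>auto simp: \<rho>_def K_def\<close>)
      also have "\<dots> \<le> \<bar>C\<bar> * (D / \<delta>) powr \<beta>"
        using q \<delta> D by (intro upper w) (auto simp: D_def Ap_const_power_weight)
      also have "\<dots> = \<bar>C\<bar> * D powr \<beta> * \<delta> powr (- \<beta>)"
        using D \<delta> by (simp add: powr_divide powr_minus divide_simps)
      finally have "(norm y * V powr (1 / 2) * exp (- 1) powr (1 / p)) * \<delta> powr (- (1 / 2))
          \<le> \<bar>C\<bar> * D powr \<beta> * \<delta> powr (- \<beta>)"
        unfolding \<open>\<rho> powr \<delta> = exp (- 1)\<close> using \<delta> by (simp only: root exp_ge_zero mult.assoc)
      then show "\<delta> powr (- (1 / 2)) \<le> \<bar>C\<bar> * D powr \<beta> / (norm y * V powr (1 / 2) * exp (- 1) powr (1 / p)) * \<delta> powr (- \<beta>)"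
        using y V by (simp add: divide_simps mult_ac)
    qed
    have "1 / 2 \<le> (q - 1) * \<beta>"
    proof (rule powr_exponent_le)
      fix \<delta> :: real assume \<delta>: "0 < \<delta>" "\<delta> < 1"
      \<comment> \<open>The dual weight of \<open>power_weight a\<close> has exponent
        \<open>\<delta> - 1\<close>, and the test function has half of it. With
        \<open>p = 2 * q\<close> this gives
        \<open>(\<delta> - 1) / 2 * p + a = \<delta> - 1\<close>.\<close>
      define a where "a = (1 - \<delta>) * (q - 1)"
      have "2 * ((\<delta> - 1) / 2) = \<delta> - 1" by simp
      have w: "power_weight a \<in> (Ap_class q :: (real ^ 'n \<Rightarrow> real) set)"
        unfolding a_def using q \<delta> by (intro power_weight_Ap_class) auto
      \<comment> \<open>The radius parameter \<open>\<rho>\<close> is 1 here, since the pointwise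
        lower bound holds on the whole unit ball.\<close>
      have "norm y * ((V / \<delta>) powr (p / 2) * 1 powr \<delta>) powr (1 / p) \<le> K_gamma_norm p (power_weight a) K"
        unfolding K_def
      proof (rule K_gamma_norm_lower_bound[where b = "(\<delta> - 1) / 2"])
        show "(\<delta> - 1) / 2 * p + a = \<delta> - 1" by (simp add: a_def q_def field_simps)
        fix s :: "real ^ 'n" assume "s \<noteq> 0" "radial_vol s \<le> 1"
        then show "ennreal (V / \<delta> * radial_vol s powr (2 * ((\<delta> - 1) / 2)))
            \<le> (\<integral>\<^sup>+t. ennreal ((max_kernel s t * truncated_power ((\<delta> - 1) / 2) t)\<^sup>2) \<partial>lebesgue)"
          using max_kernel_power_lower_bound[of s "(\<delta> - 1) / 2"] \<delta>
          unfolding \<open>2 * ((\<delta> - 1) / 2) = \<delta> - 1\<close> by (simp add: V_def)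
      qed (use assms(5) \<delta> x0 \<xi>(2) V C w in \<open>auto simp: K_def\<close>)
      also have "\<dots> \<le> \<bar>C\<bar> * ((D / \<delta>) powr (q - 1)) powr \<beta>"
        using q \<delta> by (intro upper w) (auto simp: D_def a_def Ap_const_power_weight)
      also have "\<dots> = \<bar>C\<bar> * D powr ((q - 1) * \<beta>) * \<delta> powr (- ((q - 1) * \<beta>))"
        using D \<delta> by (simp only: powr_powr) (simp add: powr_divide powr_minus divide_simps)
      finally have "(norm y * V powr (1 / 2)) * \<delta> powr (- (1 / 2))
          \<le> \<bar>C\<bar> * D powr ((q - 1) * \<beta>) * \<delta> powr (- ((q - 1) * \<beta>))"
        using root[OF \<delta>(1), of 1] by simp
      then show "\<delta> powr (- (1 / 2)) \<le> \<bar>C\<bar> * D powr ((q - 1) * \<beta>) / (norm y * V powr (1 / 2)) * \<delta> powr (- ((q - 1) * \<beta>))"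
        using y V by (simp add: divide_simps mult_ac)
    qed
    \<comment> \<open>Here \<open>q - 1\<close> is \<open>(p - 2) / 2\<close>, so the inequality
      reads \<open>1 \<le> (p - 2) * \<beta>\<close>.\<close>
    then have "1 / (p - 2) \<le> \<beta>"
      using assms(5) by (simp add: q_def field_simps)
    with \<open>1 / 2 \<le> \<beta>\<close> show ?thesis by simp
  qed
  then show ?thesis
    using weak strongly_measurable_rank_one_kernel dini_rank_one_kernel
    unfolding q_def by (intro exI[of _ K]) (auto simp: K_def)
qed
end
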